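(* Let \(G\) be a graph on \(n\) vertices, \((T,\mathcal{X})\) a tree decomposition of \(G\) of width at most \(t-1\), \(P\subseteq T\) a nonredundant path, and \(m\in\{1,\dots,n\}\). Then there is a partition \((B,W,Z)\) of \(V(G)\) into three (possibly empty) sets such that one of the following holds: 1) \(|B|=m\), \(Z=\emptyset\), and \(e_G(B,W)\leq 2t\,\Delta(G)\); or 2) \(|B|\leq m\leq |B|+|Z|\), \(0<|Z|\leq n/2\), \(e_G(B,W,Z)\leq t\,\Delta(G)\log_2\big(16/w^*(P,\mathcal{X})\big)\), and there is a tree decomposition \((T',\mathcal{X}')\) of the induced subgraph \(G[Z]\) of width at most \(t-1\) and a nonredundant path \(P'\subseteq T'\) with \(w^*(P',\mathcal{X}')\geq 2\,w^*(P,\mathcal{X})\).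
   Context: \(\Delta(G)\) is the maximum degree. For a partition \((V_1,\dots,V_k)\) of \(V(G)\), \(e_G(V_1,\dots,V_k)\) is the number of edges whose ends lie in different parts. A tree decomposition of a graph \(H\) is a pair \((T,\mathcal{X})\) where \(T\) is a tree and \(\mathcal{X}=(X^i)_{i\in V(T)}\) with \(X^i\subseteq V(H)\), such that every vertex of \(H\) lies in some \(X^i\), every edge of \(H\) is contained in some \(X^i\), and for all nodes \(i,j\) and every node \(h\) on the \(i\)–\(j\) path in \(T\), \(X^i\cap X^j\subseteq X^h\); its width is \(\max_i|X^i|-1\). For a path \(P\subseteq T\), \(w^*(P,\mathcal{X}) := |\bigcup_{i\in V(P)}X^i| / |V(H)|\). A path \(P=(i_0,i_1,\dots,i_\ell)\subseteq T\) (possibly a single node) has \(i_0\) as a nonredundant end if \(X^{i_0}\neq\emptyset\) and, when \(\ell\neq 0\), \(X^{i_h}\not\subseteq X^{i_{h-1}}\) for all \(h\in\{1,\dots,\ell\}\); \(P\) is nonredundant if one of its ends is a nonredundant end. *)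

theory Defs
  imports Complex_Main
begin

record 'a ugraph =
  verts :: "'a set"
  edges :: "'a set set"

definition simple_graph :: "'a ugraph \<Rightarrow> bool" where
  "simple_graph G \<longleftrightarrow> finite (verts G) \<and> (\<forall>e\<in>edges G. e \<subseteq> verts G \<and> card e = 2)"

definition degree :: "'a ugraph \<Rightarrow> 'a \<Rightarrow> nat" where
  "degree G v = card {e \<in> edges G. v \<in> e}"

(* Unspecified for the graph without vertices. *)
definition max_degree :: "'a ugraph \<Rightarrow> nat" where
  "max_degree G = Max (degree G ` verts G)"

definition induced :: "'a ugraph \<Rightarrow> 'a set \<Rightarrow> 'a ugraph" where
  "induced G U = \<lparr>verts = verts G \<inter> U, edges = {e \<in> edges G. e \<subseteq> U}\<rparr>"

(* Parts may be empty, hence a partition is a list of pairwise disjoint sets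
   rather than a set of sets. *)
definition ordered_partition :: "'a set list \<Rightarrow> 'a set \<Rightarrow> bool" where
  "ordered_partition Vs V \<longleftrightarrow>
     \<Union> (set Vs) = V \<and>
     (\<forall>i<length Vs. \<forall>j<length Vs. i \<noteq> j \<longrightarrow> Vs ! i \<inter> Vs ! j = {})"

definition cut_size :: "'a ugraph \<Rightarrow> 'a set list \<Rightarrow> nat" where
  "cut_size G Vs =
     card {e \<in> edges G. \<exists>i<length Vs. \<exists>j<length Vs. i \<noteq> j \<and>
             (\<exists>u v. e = {u, v} \<and> u \<in> Vs ! i \<and> v \<in> Vs ! j)}"

(* A path is given by the nonempty sequence of its vertices; a singleton list is the
   one-vertex path. *)
definition is_path :: "'a ugraph \<Rightarrow> 'a list \<Rightarrow> bool" where
  "is_path G p \<longleftrightarrow>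
     p \<noteq> [] \<and> distinct p \<and> set p \<subseteq> verts G \<and>
     (\<forall>i. Suc i < length p \<longrightarrow> {p ! i, p ! Suc i} \<in> edges G)"

definition path_between :: "'a ugraph \<Rightarrow> 'a \<Rightarrow> 'a list \<Rightarrow> 'a \<Rightarrow> bool" where
  "path_between G u p v \<longleftrightarrow> is_path G p \<and> hd p = u \<and> last p = v"

definition connected_graph :: "'a ugraph \<Rightarrow> bool" where
  "connected_graph G \<longleftrightarrow>
     verts G \<noteq> {} \<and> (\<forall>u\<in>verts G. \<forall>v\<in>verts G. \<exists>p. path_between G u p v)"

definition is_cycle :: "'a ugraph \<Rightarrow> 'a list \<Rightarrow> bool" where
  "is_cycle G p \<longleftrightarrow> is_path G p \<and> 3 \<le> length p \<and> {last p, hd p} \<in> edges G"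

definition is_tree :: "'a ugraph \<Rightarrow> bool" where
  "is_tree T \<longleftrightarrow> simple_graph T \<and> connected_graph T \<and> (\<nexists>p. is_cycle T p)"

definition tree_decomposition :: "'a ugraph \<Rightarrow> 'b ugraph \<Rightarrow> ('b \<Rightarrow> 'a set) \<Rightarrow> bool" where
  "tree_decomposition H T X \<longleftrightarrow>
     is_tree T \<and>
     (\<forall>i\<in>verts T. X i \<subseteq> verts H) \<and>
     (\<forall>v\<in>verts H. \<exists>i\<in>verts T. v \<in> X i) \<and>
     (\<forall>e\<in>edges H. \<exists>i\<in>verts T. e \<subseteq> X i) \<and>
     (\<forall>i\<in>verts T. \<forall>j\<in>verts T. \<forall>p. path_between T i p j \<longrightarrow>
        (\<forall>h\<in>set p. X i \<inter> X j \<subseteq> X h))"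

(* Integer-valued: if all bags are empty, the width is -1. *)
definition width :: "'b ugraph \<Rightarrow> ('b \<Rightarrow> 'a set) \<Rightarrow> int" where
  "width T X = int (Max ((\<lambda>i. card (X i)) ` verts T)) - 1"

definition rel_weight :: "'a ugraph \<Rightarrow> ('b \<Rightarrow> 'a set) \<Rightarrow> 'b list \<Rightarrow> real" where
  "rel_weight H X P = real (card (\<Union>i\<in>set P. X i)) / real (card (verts H))"

(* The first node of the path is a nonredundant end. *)
definition nonredundant_start :: "('b \<Rightarrow> 'a set) \<Rightarrow> 'b list \<Rightarrow> bool" where
  "nonredundant_start X P \<longleftrightarrow>
     X (hd P) \<noteq> {} \<and> (\<forall>h\<in>{1..<length P}. \<not> X (P ! h) \<subseteq> X (P ! (h - 1)))"

definition nonredundant :: "('b \<Rightarrow> 'a set) \<Rightarrow> 'b list \<Rightarrow> bool" where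
  "nonredundant X P \<longleftrightarrow> nonredundant_start X P \<or> nonredundant_start X (rev P)"

end

theory Submission
  imports Defs
begin

text \<open>
  Root the decomposition at one end of \<open>P\<close> and let every vertex belong to its topmost bag. Let
  \<open>R\<close> be the set of vertices in the bags of \<open>P\<close>, and \<open>S\<^sub>h\<close> the set of the other vertices whose
  topmost bag hangs off the \<open>h\<close>-th node of \<open>P\<close>. Arrange the vertices on a circle in the order
  \<open>S\<^sub>0\<close>, then the vertices of \<open>R\<close> with topmost bag \<open>0\<close>, then \<open>S\<^sub>1\<close>, and so on. Cutting the circle
  next to a vertex of \<open>R\<close> only cuts edges incident to one bag. So if two vertices of \<open>R\<close> are at
  distance \<open>m\<close>, an arc of length \<open>m\<close> is the required set \<open>B\<close>.

  Otherwise \<open>R\<close> shifted by \<open>m\<close> or by \<open>-m\<close> lies in the union of the \<open>S\<^sub>h\<close>. For each \<open>h\<close> and each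
  of the two shifts take the smallest arc that contains the vertices of \<open>R\<close> shifted into \<open>S\<^sub>h\<close>. The
  arcs belonging to one shift are disjoint from each other and from the \<open>S\<^sub>h\<close> met by the other
  shift, so by averaging some arc \<open>Z\<close> with its \<open>S\<^sub>h\<close> satisfies
  \<open>|R| (|S\<^sub>h| + |Z|) \<le> n |R \<inter> Z|\<close>. As \<open>|Z| \<le> |S\<^sub>h|\<close>, the density of \<open>R\<close> in \<open>Z\<close> is at least
  twice that in \<open>G\<close>; as \<open>|R \<inter> Z| \<le> |Z|\<close>, also \<open>|S\<^sub>h| / |Z| \<le> n / |R|\<close>. Repeatedly halving \<open>S\<^sub>h\<close> by
  balanced bags cuts off a part of it whose size is prescribed up to \<open>|Z|\<close>, and this needs about
  \<open>log\<^sub>2 (n / |R|)\<close> bags. The path in \<open>G[Z]\<close> is \<open>P\<close> with its redundant nodes dropped.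
\<close>

section \<open>Enumerating the nodes of a tree decomposition\<close>

lemma is_path_Cons:
  assumes "is_path G p" "x \<notin> set p" "x \<in> verts G" "{x, hd p} \<in> edges G"
  shows "is_path G (x # p)"
  unfolding is_path_def
proof (intro conjI allI impI)
  fix i assume i: "Suc i < length (x # p)"
  show "{(x # p) ! i, (x # p) ! Suc i} \<in> edges G"
  proof (cases i)
    case 0
    then show ?thesis using assms by (simp add: is_path_def hd_conv_nth)
  next
    case (Suc k)
    then show ?thesis using assms(1) i by (simp add: is_path_def)
  qed
qed (use assms in \<open>auto simp: is_path_def\<close>)

lemma is_path_edge:
  assumes "is_path G p" "0 < j" "j < length p"
  shows "{p ! (j - 1), p ! j} \<in> edges G"
proof -
  have "Suc (j - 1) < length p \<longrightarrow> {p ! (j - 1), p ! Suc (j - 1)} \<in> edges G"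
    using assms(1) unfolding is_path_def by blast
  then show ?thesis using assms(2,3) by simp
qed

lemma is_path_rev:
  assumes "is_path G p"
  shows "is_path G (rev p)"
  unfolding is_path_def
proof (intro conjI allI impI)
  fix i assume i: "Suc i < length (rev p)"
  define k where "k = length p - Suc (Suc i)"
  have "rev p ! i = p ! Suc k" "rev p ! Suc i = p ! k" "Suc k < length p"
    using i by (auto simp: rev_nth k_def intro!: arg_cong[where f = "(!) p"])
  then show "{rev p ! i, rev p ! Suc i} \<in> edges G"
    using assms by (auto simp: is_path_def insert_commute)
qed (use assms in \<open>auto simp: is_path_def\<close>)

lemma path_between_rev:
  "path_between G u p v \<Longrightarrow> path_between G v (rev p) u"
  by (auto simp: path_between_def is_path_rev hd_rev last_rev)

lemma path_between_Cons:
  assumes "path_between G y p v" "x \<notin> set p" "x \<in> verts G" "{x, y} \<in> edges G"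
  shows "path_between G x (x # p) v"
proof -
  have p: "is_path G p" "hd p = y" "last p = v" "p \<noteq> []"
    using assms(1) by (auto simp: path_between_def is_path_def)
  then show ?thesis
    using is_path_Cons[OF p(1) assms(2,3)] assms(4) by (simp add: path_between_def)
qed

text \<open>A search order: each prefix spans a connected subgraph, and an earlier neighbour can
  serve as parent. Lists are used so that a given path can be the initial segment of the
  enumeration.\<close>

definition grown :: "'b ugraph \<Rightarrow> 'b list \<Rightarrow> bool" where
  "grown T fs \<longleftrightarrow> distinct fs \<and> set fs \<subseteq> verts T \<and>
     (\<forall>j<length fs. 0 < j \<longrightarrow> (\<exists>i<j. {fs ! j, fs ! i} \<in> edges T))"

lemma is_path_grown:
  assumes "is_path T p"
  shows "grown T p"
  unfolding grown_def
proof (intro conjI allI impI)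
  fix j assume j: "j < length p" "0 < j"
  show "\<exists>i<j. {p ! j, p ! i} \<in> edges T"
    using is_path_edge[OF assms j(2,1)] j
    by (intro exI[of _ "j - 1"]) (simp add: insert_commute)
qed (use assms in \<open>auto simp: is_path_def\<close>)

text \<open>Induction on the prefix: the new node is put in front of a path from an earlier
  neighbour. Since that path stays inside the prefix, the new node does not occur on it.\<close>

lemma grown_prefix_path:
  assumes "grown T fs"
  shows "j \<le> length fs \<Longrightarrow> a \<in> set (take j fs) \<Longrightarrow> b \<in> set (take j fs) \<Longrightarrow>
    \<exists>p. path_between T a p b \<and> set p \<subseteq> set (take j fs)"
proof (induction j arbitrary: a b)
  case 0
  then show ?case by simp
next
  case (Suc j)
  have jl: "j < length fs" using Suc.prems by simp
  have tk: "set (take (Suc j) fs) = insert (fs ! j) (set (take j fs))"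
    using jl by (simp add: take_Suc_conv_app_nth)
  have new: "fs ! j \<notin> set (take j fs)"
    using assms jl by (auto simp: grown_def in_set_conv_nth nth_eq_iff_index_eq)
  have inV: "fs ! j \<in> verts T"
    using assms jl by (auto simp: grown_def)
  have single: "path_between T (fs ! j) [fs ! j] (fs ! j)"
    using inV by (auto simp: path_between_def is_path_def)
  have ext: "\<exists>p. path_between T (fs ! j) p c \<and> set p \<subseteq> set (take (Suc j) fs)"
    if c: "c \<in> set (take j fs)" for c
  proof -
    have "0 < j" using c by (cases j) auto
    then obtain i where i: "i < j" "{fs ! j, fs ! i} \<in> edges T"
      using assms jl by (auto simp: grown_def)
    have "fs ! i \<in> set (take j fs)"
      using i jl by (auto simp: in_set_conv_nth)
    then obtain p where "path_between T (fs ! i) p c" "set p \<subseteq> set (take j fs)"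
      using Suc.IH[of "fs ! i" c] c jl by auto
    then show ?thesis
      using path_between_Cons[of T "fs ! i" p c "fs ! j"] i new inV tk
      by (intro exI[of _ "fs ! j # p"]) auto
  qed
  consider "a \<in> set (take j fs)" "b \<in> set (take j fs)" | "a = fs ! j" "b = fs ! j"
    | "a = fs ! j" "b \<in> set (take j fs)" | "a \<in> set (take j fs)" "b = fs ! j"
    using Suc.prems tk by auto
  then show ?case
  proof cases
    case 1
    then show ?thesis using Suc.IH[of a b] jl tk by auto
  next
    case 2
    then show ?thesis using single tk by (intro exI[of _ "[fs ! j]"]) auto
  next
    case 3
    then show ?thesis using ext by blast
  next
    case 4
    then show ?thesis using ext[of a] path_between_rev by (metis set_rev)
  qed
qed

text \<open>The edge sought enters the first vertex outside \<open>A\<close> on a path that starts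
  in \<open>A\<close> and ends outside.\<close>

lemma connected_boundary_edge:
  assumes "connected_graph T" "A \<subseteq> verts T" "A \<noteq> {}" "A \<noteq> verts T"
  obtains a x where "a \<in> A" "x \<in> verts T - A" "{x, a} \<in> edges T"
proof -
  obtain u v where uv: "u \<in> A" "v \<in> verts T - A" using assms by blast
  then have "u \<in> verts T" "v \<in> verts T" using assms(2) by auto
  then obtain p where p: "is_path T p" "hd p = u" "last p = v"
    using assms(1) unfolding connected_graph_def path_between_def by blast
  let ?P = "\<lambda>k. k < length p \<and> p ! k \<notin> A"
  have "?P (length p - 1)"
    using p uv by (auto simp: is_path_def last_conv_nth)
  then have k: "?P (LEAST k. ?P k)" by (rule LeastI)
  define k where "k = (LEAST k. ?P k)"
  have "k \<noteq> 0" using k p uv by (metis DiffD2 hd_conv_nth is_path_def k_def)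
  then have "\<not> ?P (k - 1)"
    using not_less_Least[of "k - 1" ?P] by (simp add: k_def)
  moreover have "k < length p" "p ! k \<notin> A" using k by (simp_all add: k_def)
  moreover have "p ! k \<in> verts T"
    using p(1) \<open>k < length p\<close> nth_mem[of k p] unfolding is_path_def by blast
  ultimately have "p ! (k - 1) \<in> A" "{p ! (k - 1), p ! k} \<in> edges T" "p ! k \<in> verts T - A"
    using is_path_edge[OF p(1), of k] \<open>k \<noteq> 0\<close> by auto
  then show ?thesis using that by (metis insert_commute)
qed

lemma grown_extend:
  assumes "connected_graph T" "finite (verts T)" "grown T fs" "fs \<noteq> []"
  shows "\<exists>gs. grown T (fs @ gs) \<and> set (fs @ gs) = verts T"
  using assms(3,4)
proof (induction "card (verts T - set fs)" arbitrary: fs rule: less_induct)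
  case less
  have sub: "set fs \<subseteq> verts T" using less.prems by (simp add: grown_def)
  show ?case
  proof (cases "set fs = verts T")
    case True
    then show ?thesis using less.prems by (intro exI[of _ "[]"]) simp
  next
    case False
    obtain a x where ax: "a \<in> set fs" "x \<in> verts T - set fs" "{x, a} \<in> edges T"
      using connected_boundary_edge[OF assms(1) sub _ False] less.prems by auto
    have "\<exists>i<j. {(fs @ [x]) ! j, (fs @ [x]) ! i} \<in> edges T"
      if j: "j < length (fs @ [x])" "0 < j" for j
    proof (cases "j = length fs")
      case True
      obtain i where "i < length fs" "fs ! i = a" using ax by (auto simp: in_set_conv_nth)
      then show ?thesis using True ax by (intro exI[of _ i]) (auto simp: nth_append)
    next
      case False
      then have "j < length fs" using j by simp
      then obtain i where "i < j" "{fs ! j, fs ! i} \<in> edges T"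
        using less.prems(1) j unfolding grown_def by blast
      then show ?thesis using False j by (intro exI[of _ i]) (auto simp: nth_append)
    qed
    then have "grown T (fs @ [x])"
      using less.prems(1) ax by (auto simp: grown_def)
    moreover have "card (verts T - set (fs @ [x])) < card (verts T - set fs)"
      using ax assms(2) by (intro psubset_card_mono) auto
    ultimately obtain gs where "grown T ((fs @ [x]) @ gs) \<and> set ((fs @ [x]) @ gs) = verts T"
      using less.hyps[of "fs @ [x]"] by auto
    then show ?thesis by (intro exI[of _ "x # gs"]) simp
  qed
qed

text \<open>Trades the tree for the natural numbers with a parent function, rooted at the first node
  of \<open>P\<close>, which becomes the initial segment. Empty bags from \<open>N\<close> on allow
  the bag conditions to be stated for all indices.\<close>

lemma tree_decomposition_enumeration:
  assumes td: "tree_decomposition G T X" and w: "width T X \<le> int t - 1" and P: "is_path T P"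
  obtains Y par N where
    "\<And>j. par j \<le> j - 1"
    "\<And>i j. i < j \<Longrightarrow> Y j \<inter> Y i \<subseteq> Y (par j)"
    "\<And>j. Y j \<subseteq> verts G" "\<And>j. card (Y j) \<le> t"
    "\<And>v. v \<in> verts G \<Longrightarrow> \<exists>j. v \<in> Y j"
    "\<And>e. e \<in> edges G \<Longrightarrow> \<exists>j. e \<subseteq> Y j"
    "\<And>j. N \<le> j \<Longrightarrow> Y j = {}"
    "length P \<le> N" "\<And>j. j < length P \<Longrightarrow> Y j = X (P ! j)" "\<And>j. j < length P \<Longrightarrow> par j = j - 1"
proof -
  have T: "connected_graph T" "finite (verts T)"
    using td by (auto simp: tree_decomposition_def is_tree_def simple_graph_def)
  have P0: "P \<noteq> []" using P by (simp add: is_path_def)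
  obtain gs where gs: "grown T (P @ gs)" "set (P @ gs) = verts T"
    using grown_extend[OF T is_path_grown[OF P] P0] by blast
  define L where "L = P @ gs"
  define N where "N = length L"
  define Y where "Y = (\<lambda>j. if j < N then X (L ! j) else {})"
  \<comment> \<open>For \<open>j = 0\<close> truncated subtraction makes the root its own parent;
    \<open>j - 1\<close> is also the choice along \<open>P\<close> and from \<open>N\<close> on.
    Elsewhere an earlier neighbour is taken.\<close>
  have ex: "\<exists>i. i \<le> j - 1 \<and> (0 < j \<longrightarrow> j < N \<longrightarrow> {L ! j, L ! i} \<in> edges T) \<and>
      (j < length P \<longrightarrow> i = j - 1)" for j
  proof (cases "0 < j \<and> j < N")
    case True
    show ?thesis
    proof (cases "j < length P")
      case True
      have "{P ! (j - 1), P ! j} \<in> edges T"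
        using is_path_edge[OF P] True \<open>0 < j \<and> j < N\<close> by simp
      with True show ?thesis
        by (intro exI[of _ "j - 1"]) (auto simp: L_def nth_append insert_commute)
    next
      case False
      obtain i where "i < j" "{L ! j, L ! i} \<in> edges T"
        using gs(1) \<open>0 < j \<and> j < N\<close> unfolding grown_def L_def[symmetric] N_def by auto
      then show ?thesis using False by (intro exI[of _ i]) auto
    qed
  qed (auto intro: exI[of _ "j - 1"])
  then obtain par where par: "\<And>j. par j \<le> j - 1"
      "\<And>j. 0 < j \<Longrightarrow> j < N \<Longrightarrow> {L ! j, L ! par j} \<in> edges T"
      "\<And>j. j < length P \<Longrightarrow> par j = j - 1"
    by metis
  have set: "set L = verts T" and gr: "grown T L" using gs by (auto simp: L_def)
  \<comment> \<open>A path from the parent of \<open>j\<close> to \<open>i\<close> inside the prefix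
    misses \<open>j\<close>, so putting \<open>j\<close> in front gives a path of the tree through
    the parent, to which the decomposition axiom applies.\<close>
  have conn: "Y j \<inter> Y i \<subseteq> Y (par j)" if ij: "i < j" for i j
  proof (cases "j < N")
    case True
    have pj: "par j < j" using par(1)[of j] ij by simp
    have "L ! par j \<in> set (take j L)" "L ! i \<in> set (take j L)"
      using pj ij True by (auto simp: in_set_conv_nth N_def)
    then obtain p where p: "path_between T (L ! par j) p (L ! i)" "set p \<subseteq> set (take j L)"
      using grown_prefix_path[OF gr] True N_def less_imp_le by blast
    have "L ! j \<notin> set (take j L)"
      using gr True by (auto simp: grown_def N_def in_set_conv_nth nth_eq_iff_index_eq)
    then have "L ! j \<notin> set p" using p(2) by blast
    moreover have Lv: "L ! j \<in> verts T" "L ! i \<in> verts T"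
      using set True ij nth_mem[of _ L] by (auto simp: N_def)
    moreover have "{L ! j, L ! par j} \<in> edges T" using par(2)[of j] ij True by simp
    ultimately have "path_between T (L ! j) (L ! j # p) (L ! i)"
      by (intro path_between_Cons[OF p(1)])
    moreover have "L ! par j \<in> set (L ! j # p)"
      using p(1) hd_in_set[of p] by (auto simp: path_between_def is_path_def)
    ultimately have "X (L ! j) \<inter> X (L ! i) \<subseteq> X (L ! par j)"
      using td Lv unfolding tree_decomposition_def by blast
    then show ?thesis using True pj ij by (auto simp: Y_def)
  qed (simp add: Y_def)
  have in_L: "\<exists>j<N. L ! j = i" if "i \<in> verts T" for i
    using that set by (auto simp: N_def in_set_conv_nth)
  have inv: "L ! j \<in> verts T" if "j < N" for j using that set nth_mem[of j L] by (auto simp: N_def)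
  show ?thesis
  proof (rule that[of par Y N])
    show "Y j \<subseteq> verts G" for j
      using td inv by (auto simp: Y_def tree_decomposition_def)
    show "card (Y j) \<le> t" for j
    proof (cases "j < N")
      case True
      then have "card (X (L ! j)) \<le> Max ((\<lambda>i. card (X i)) ` verts T)"
        using inv T by (intro Max_ge) auto
      then show ?thesis using w True by (simp add: Y_def width_def)
    qed (simp add: Y_def)
    show "\<exists>j. v \<in> Y j" if "v \<in> verts G" for v
    proof -
      obtain i where "i \<in> verts T" "v \<in> X i" using td \<open>v \<in> verts G\<close> by (auto simp: tree_decomposition_def)
      then show ?thesis using in_L[of i] by (auto simp: Y_def)
    qed
    show "\<exists>j. e \<subseteq> Y j" if "e \<in> edges G" for e
    proof -
      obtain i where "i \<in> verts T" "e \<subseteq> X i" using td \<open>e \<in> edges G\<close> by (auto simp: tree_decomposition_def)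
      then show ?thesis using in_L[of i] by (auto simp: Y_def)
    qed
  qed (use par conn in \<open>auto simp: Y_def N_def L_def nth_append\<close>)
qed

section \<open>Trees given by a parent function\<close>

definition parent_tree :: "nat \<Rightarrow> (nat \<Rightarrow> nat) \<Rightarrow> nat ugraph" where
  "parent_tree N par = \<lparr>verts = {..<N}, edges = {{j, par j} | j. 0 < j \<and> j < N}\<rparr>"

lemma parent_tree_edge:
  assumes "\<And>j. 0 < j \<Longrightarrow> j < N \<Longrightarrow> par j < j" "{a, b} \<in> edges (parent_tree N par)" "a \<le> b"
  shows "a = par b"
proof -
  obtain j where "{a, b} = {j, par j}" "0 < j" "j < N"
    using assms(2) by (auto simp: parent_tree_def)
  then show ?thesis using assms(1)[of j] assms(3) by (auto simp: doubleton_eq_iff)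
qed

text \<open>Both neighbours of an inner maximum would have to be its parent, but the nodes of a path
  are distinct.\<close>

lemma parent_tree_no_local_max:
  assumes par: "\<And>j. 0 < j \<Longrightarrow> j < N \<Longrightarrow> par j < j" and p: "is_path (parent_tree N par) p"
    and max: "\<And>x. x \<in> set p \<Longrightarrow> x \<le> p ! k" and k: "k < length p"
  shows "k = 0 \<or> k = length p - 1"
proof (rule ccontr)
  assume "\<not> ?thesis"
  then have k': "0 < k" "Suc k < length p" using k by auto
  let ?E = "edges (parent_tree N par)"
  have E: "{p ! (k - 1), p ! k} \<in> ?E" "{p ! Suc k, p ! k} \<in> ?E"
    using is_path_edge[OF p, of k] is_path_edge[OF p, of "Suc k"] k' by (auto simp: insert_commute)
  have "p ! (k - 1) \<le> p ! k" "p ! Suc k \<le> p ! k" using max k' by auto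
  then have "p ! (k - 1) = p ! Suc k"
    using parent_tree_edge[OF par E(1)] parent_tree_edge[OF par E(2)] by simp
  then show False
    using p k' by (auto simp: is_path_def nth_eq_iff_index_eq)
qed

text \<open>Connected because \<open>0, ..., N - 1\<close> is a search order. On a cycle the largest
  node is an end of the listed path, and its neighbours along the path and along the closing edge
  would both be its parent.\<close>

lemma is_tree_parent_tree:
  assumes par: "\<And>j. 0 < j \<Longrightarrow> j < N \<Longrightarrow> par j < j" and N: "0 < N"
  shows "is_tree (parent_tree N par)"
proof -
  let ?T = "parent_tree N par"
  have vT: "verts ?T = {..<N}" by (simp add: parent_tree_def)
  have "e \<subseteq> verts ?T \<and> card e = 2" if e: "e \<in> edges ?T" for e
  proof -
    obtain j where "e = {j, par j}" "0 < j" "j < N" using e by (auto simp: parent_tree_def)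
    then show ?thesis using par[of j] by (simp add: vT)
  qed
  then have "simple_graph ?T" by (simp add: simple_graph_def vT)
  moreover have "connected_graph ?T"
  proof -
    have "grown ?T [0..<N]"
      unfolding grown_def
    proof (intro conjI allI impI)
      fix j assume "j < length [0..<N]" "0 < j"
      then show "\<exists>i<j. {[0..<N] ! j, [0..<N] ! i} \<in> edges ?T"
        using par[of j] by (intro exI[of _ "par j"]) (auto simp: parent_tree_def)
    qed (auto simp: vT)
    from grown_prefix_path[OF this, of N]
    have "\<exists>p. path_between ?T u p v" if "u < N" "v < N" for u v using that by fastforce
    then show ?thesis using N by (auto simp: connected_graph_def vT)
  qed
  moreover have False if c: "is_cycle ?T p" for p
  proof -
    have p: "is_path ?T p" and len: "3 \<le> length p" and e: "{last p, hd p} \<in> edges ?T"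
      using c by (auto simp: is_cycle_def)
    have p0: "p \<noteq> []" using len by auto
    obtain k where k: "k < length p" "p ! k = Max (set p)"
      using Max_in[of "set p"] p0 by (auto simp: in_set_conv_nth)
    have max: "x \<le> p ! k" if "x \<in> set p" for x using that k by simp
    have E: "{p ! i, p ! Suc i} \<in> edges ?T" if "Suc i < length p" for i
      using p that by (auto simp: is_path_def)
    have pe: "p ! j = par (p ! k)" if "{p ! j, p ! k} \<in> edges ?T" "j < length p" for j
      using parent_tree_edge[OF par that(1)] max that by auto
    have dist: "p ! i \<noteq> p ! j" if "i < length p" "j < length p" "i \<noteq> j" for i j
      using p that by (auto simp: is_path_def nth_eq_iff_index_eq)
    have hl: "hd p = p ! 0" "last p = p ! (length p - 1)"
      using p0 by (auto simp: hd_conv_nth last_conv_nth)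
    from parent_tree_no_local_max[OF par p max k(1)] show False
    proof
      assume k0: "k = 0"
      have "p ! 1 = par (p ! k)"
        using E[of 0] len k0 by (intro pe) (auto simp: insert_commute)
      moreover have "p ! (length p - 1) = par (p ! k)"
        using e len k0 hl by (intro pe) auto
      ultimately have "p ! 1 = p ! (length p - 1)" by simp
      moreover have "1 < length p" "length p - 1 < length p" "1 \<noteq> length p - 1"
        using len by linarith+
      ultimately show False using dist by blast
    next
      assume kl: "k = length p - 1"
      have "{p ! (length p - 2), p ! k} \<in> edges ?T"
        using E[of "length p - 2"] len kl by (auto simp: numeral_2_eq_2 Suc_diff_Suc)
      then have "p ! (length p - 2) = par (p ! k)"
        using len by (intro pe) auto
      moreover have "p ! 0 = par (p ! k)"
        using e p0 kl hl by (intro pe) (auto simp: insert_commute)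
      ultimately have "p ! 0 = p ! (length p - 2)" by simp
      moreover have "0 < length p" "length p - 2 < length p" "0 \<noteq> length p - 2"
        using len by linarith+
      ultimately show False using dist by blast
    qed
  qed
  ultimately show ?thesis by (auto simp: is_tree_def)
qed

text \<open>The largest node of a path is one of its ends, and its neighbour there is its parent, so
  the path may be shortened at that end.\<close>

lemma parent_tree_path_bags:
  assumes par: "\<And>j. 0 < j \<Longrightarrow> j < N \<Longrightarrow> par j < j"
    and conn: "\<And>i j. i < j \<Longrightarrow> j < N \<Longrightarrow> Y j \<inter> Y i \<subseteq> Y (par j)"
  shows "is_path (parent_tree N par) p \<Longrightarrow> v \<in> Y (hd p) \<Longrightarrow> v \<in> Y (last p) \<Longrightarrow> h \<in> set p
    \<Longrightarrow> v \<in> Y h"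
proof (induction "length p" arbitrary: p h rule: less_induct)
  case less
  let ?T = "parent_tree N par"
  \<comment> \<open>Stated for a path that starts at its largest node, so that it applies to
    \<open>p\<close> and to \<open>rev p\<close>; hence the induction hypothesis is passed as a
    premise.\<close>
  have main: "v \<in> Y h" if p: "is_path ?T p" "v \<in> Y (hd p)" "v \<in> Y (last p)" "h \<in> set p"
    and max: "\<And>x. x \<in> set p \<Longrightarrow> x \<le> hd p"
    and IH: "\<And>q. length q < length p \<Longrightarrow> is_path ?T q \<Longrightarrow> v \<in> Y (hd q) \<Longrightarrow> v \<in> Y (last q)
       \<Longrightarrow> h \<in> set q \<Longrightarrow> v \<in> Y h" for p
  proof -
    obtain a q where pq: "p = a # q" using p by (cases p) (auto simp: is_path_def)
    show ?thesis
    proof (cases "q = []")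
      case True
      then show ?thesis using p pq by auto
    next
      case False
      have E: "{hd q, a} \<in> edges ?T"
        using is_path_edge[OF p(1), of 1] pq False by (simp add: hd_conv_nth insert_commute)
      have hq: "hd q = par a"
        using parent_tree_edge[OF par E] max[of "hd q"] pq False by simp
      have "last q < a"
      proof -
        have "last q \<in> set q" "a \<notin> set q" using p(1) pq False by (auto simp: is_path_def)
        then have "last q \<le> a" "last q \<noteq> a" using max[of "last q"] pq by auto
        then show ?thesis by simp
      qed
      moreover have "a < N" using p(1) pq by (auto simp: is_path_def parent_tree_def)
      ultimately have "v \<in> Y (hd q)"
        using conn[of "last q" a] p pq hq False by auto
      moreover have "is_path ?T q"
        unfolding is_path_def
      proof (intro conjI allI impI)
        fix i assume "Suc i < length q"
        then show "{q ! i, q ! Suc i} \<in> edges ?T"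
          using is_path_edge[OF p(1), of "Suc (Suc i)"] pq by simp
      qed (use p(1) pq False in \<open>auto simp: is_path_def\<close>)
      ultimately show ?thesis
        using IH[of q] p pq False by auto
    qed
  qed
  have p0: "p \<noteq> []" using less.prems by (simp add: is_path_def)
  obtain k where k: "k < length p" "p ! k = Max (set p)"
    using Max_in[of "set p"] p0 by (auto simp: in_set_conv_nth)
  have max: "x \<le> p ! k" if "x \<in> set p" for x using that k by simp
  have "hd p = p ! k \<or> hd (rev p) = p ! k"
    using parent_tree_no_local_max[OF par less.prems(1) max k(1)] p0
    by (auto simp: hd_conv_nth hd_rev last_conv_nth)
  then show ?case
  proof
    assume "hd p = p ! k"
    then show ?thesis using main[OF less.prems _ less.hyps] max by simp
  next
    assume "hd (rev p) = p ! k"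
    then show ?thesis
      using main[OF is_path_rev[OF less.prems(1)] _ _ _ _ less.hyps] less.prems max
      by (simp add: hd_rev last_rev)
  qed
qed

text \<open>Attaching bags one by one is insensitive to dropping a bag contained in another one, which
  is how redundant bags of a path are eliminated.\<close>

fun attachable :: "'a set set \<Rightarrow> 'a set list \<Rightarrow> bool" where
  "attachable \<A> [] \<longleftrightarrow> True"
| "attachable \<A> (Y # rs) \<longleftrightarrow> (\<exists>A\<in>\<A>. Y \<inter> \<Union>\<A> \<subseteq> A) \<and> attachable (insert Y \<A>) rs"

text \<open>Only the union of the earlier bags and the sets they can contain matter, and adding
  \<open>Y\<close> to both families preserves both conditions.\<close>

lemma attachable_mono:
  "attachable \<A> rs \<Longrightarrow> \<Union>\<A> = \<Union>\<B> \<Longrightarrow> (\<And>A. A \<in> \<A> \<Longrightarrow> \<exists>B\<in>\<B>. A \<subseteq> B) \<Longrightarrow> attachable \<B> rs"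
proof (induction rs arbitrary: \<A> \<B>)
  case (Cons Y rs)
  obtain A where A: "A \<in> \<A>" "Y \<inter> \<Union>\<A> \<subseteq> A" and at: "attachable (insert Y \<A>) rs"
    using Cons.prems(1) by auto
  obtain B where B: "B \<in> \<B>" "A \<subseteq> B" using Cons.prems(3)[OF A(1)] by blast
  have "attachable (insert Y \<B>) rs"
  proof (rule Cons.IH[OF at])
    show "\<Union> (insert Y \<A>) = \<Union> (insert Y \<B>)" using Cons.prems(2) by simp
    show "\<exists>B\<in>insert Y \<B>. A \<subseteq> B" if A: "A \<in> insert Y \<A>" for A
      using A Cons.prems(3)[of A] by (cases "A = Y") auto
  qed
  moreover have "Y \<inter> \<Union>\<B> \<subseteq> B" using A(2) B(2) Cons.prems(2) by simp
  ultimately show ?case using B(1) by auto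
qed simp

lemma attachable_map:
  assumes "\<And>j. 0 < j \<Longrightarrow> par j < j" "\<And>i j. i < j \<Longrightarrow> Y j \<inter> Y i \<subseteq> Y (par j)" "0 < k"
  shows "attachable (Y ` {..<k}) (map Y [k..<k + d])"
  using assms(3)
proof (induction d arbitrary: k)
  case (Suc d)
  have "Y k \<inter> Y i \<subseteq> Y (par k)" if "i < k" for i using assms(2)[OF that] .
  then have "Y k \<inter> \<Union> (Y ` {..<k}) \<subseteq> Y (par k)" by auto
  moreover have "Y (par k) \<in> Y ` {..<k}" using assms(1) Suc.prems by auto
  moreover have "attachable (insert (Y k) (Y ` {..<k})) (map Y [Suc k..<Suc k + d])"
    using Suc.IH[of "Suc k"] by (simp add: lessThan_Suc)
  ultimately show ?case by (auto simp: upt_conv_Cons simp del: upt_Suc)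
qed simp

text \<open>Recovers a parent index from a condition on sets: the bag at position
  \<open>length qs\<close> is handled at once, later ones after moving it to the end of
  \<open>qs\<close>.\<close>

lemma attachable_parent:
  "attachable (set qs) rs \<Longrightarrow> length qs \<le> j \<Longrightarrow> j < length (qs @ rs) \<Longrightarrow>
    \<exists>p<j. \<forall>i<j. (qs @ rs) ! j \<inter> (qs @ rs) ! i \<subseteq> (qs @ rs) ! p"
proof (induction rs arbitrary: qs)
  case (Cons Y rs)
  show ?case
  proof (cases "j = length qs")
    case True
    obtain A where A: "A \<in> set qs" "Y \<inter> \<Union> (set qs) \<subseteq> A" using Cons.prems by auto
    then obtain p where "p < length qs" "qs ! p = A" by (auto simp: in_set_conv_nth)
    moreover have "Y \<inter> qs ! i \<subseteq> A" if "i < length qs" for i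
      using A(2) nth_mem[OF that] by blast
    ultimately show ?thesis
      using True by (intro exI[of _ p]) (simp add: nth_append)
  next
    case False
    then show ?thesis using Cons.IH[of "qs @ [Y]"] Cons.prems by simp
  qed
qed auto

text \<open>The connectivity condition for a path rooted at its first node, with
  \<open>j - 1\<close> as the parent of \<open>j\<close>.\<close>

definition bag_path :: "'a set list \<Rightarrow> bool" where
  "bag_path qs \<longleftrightarrow> (\<forall>j<length qs. \<forall>i<j. qs ! j \<inter> qs ! i \<subseteq> qs ! (j - 1))"

lemma bag_path_snoc:
  assumes "bag_path qs" "qs \<noteq> [] \<Longrightarrow> Y \<inter> \<Union> (set qs) \<subseteq> last qs"
  shows "bag_path (qs @ [Y])"
  unfolding bag_path_def
proof (intro allI impI)
  fix j i assume j: "j < length (qs @ [Y])" "i < j"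
  show "(qs @ [Y]) ! j \<inter> (qs @ [Y]) ! i \<subseteq> (qs @ [Y]) ! (j - 1)"
  proof (cases "j = length qs")
    case True
    then have "qs ! i \<in> set qs" "qs \<noteq> []" using j by auto
    moreover from this have "Y \<inter> qs ! i \<subseteq> last qs" using assms(2) by blast
    ultimately show ?thesis using True j by (simp add: nth_append last_conv_nth)
  next
    case False
    then show ?thesis using j assms(1) by (auto simp: nth_append bag_path_def)
  qed
qed

text \<open>Scan from the left, start at the first nonempty bag, and drop a bag contained in the
  last one kept. The invariant \<open>last ps \<subseteq> last qs\<close> ensures that a newly kept
  bag meets the earlier ones only inside its new predecessor.\<close>

lemma bag_path_nonredundant:
  "bag_path ps \<Longrightarrow> \<Union> (set ps) \<noteq> {} \<Longrightarrow> \<exists>qs. bag_path qs \<and> qs \<noteq> [] \<and> set qs \<subseteq> set ps \<and>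
     \<Union> (set qs) = \<Union> (set ps) \<and> (\<forall>A\<in>set ps. \<exists>B\<in>set qs. A \<subseteq> B) \<and> last ps \<subseteq> last qs \<and>
     hd qs \<noteq> {} \<and> (\<forall>h. 1 \<le> h \<longrightarrow> h < length qs \<longrightarrow> \<not> qs ! h \<subseteq> qs ! (h - 1))"
proof (induction ps rule: rev_induct)
  case (snoc Y ps)
  have bp: "bag_path ps"
    unfolding bag_path_def
  proof (intro allI impI)
    fix j i assume "j < length ps" "i < j"
    then show "ps ! j \<inter> ps ! i \<subseteq> ps ! (j - 1)"
      using snoc.prems(1)[unfolded bag_path_def, rule_format, of j i]
      by (simp add: nth_append less_imp_diff_less)
  qed
  show ?case
  proof (cases "\<Union> (set ps) = {}")
    case True
    then show ?thesis using snoc.prems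
      by (intro exI[of _ "[Y]"]) (auto simp: bag_path_def)
  next
    case False
    have last_ps: "Y \<inter> \<Union> (set ps) \<subseteq> last ps"
    proof -
      have ps0: "ps \<noteq> []" using False by auto
      have "Y \<inter> ps ! i \<subseteq> ps ! (length ps - 1)" if "i < length ps" for i
        using snoc.prems(1)[unfolded bag_path_def, rule_format, of "length ps" i] that ps0
        by (simp add: nth_append)
      then have "Y \<inter> A \<subseteq> last ps" if "A \<in> set ps" for A
        using that ps0 by (metis in_set_conv_nth last_conv_nth)
      then show ?thesis by blast
    qed
    obtain qs where qs: "bag_path qs" "qs \<noteq> []" "set qs \<subseteq> set ps" "\<Union> (set qs) = \<Union> (set ps)"
      "\<forall>A\<in>set ps. \<exists>B\<in>set qs. A \<subseteq> B" "last ps \<subseteq> last qs" "hd qs \<noteq> {}"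
      "\<forall>h. 1 \<le> h \<longrightarrow> h < length qs \<longrightarrow> \<not> qs ! h \<subseteq> qs ! (h - 1)"
      using snoc.IH[OF bp False] by blast
    show ?thesis
    proof (cases "Y \<subseteq> last qs")
      case True
      moreover have "last qs \<in> set qs" using qs by simp
      moreover from calculation have "\<Union> (set qs) = \<Union> (set (ps @ [Y]))"
        using qs(4) by auto
      ultimately show ?thesis using qs by (intro exI[of _ qs]) auto
    next
      case False
      have "bag_path (qs @ [Y])" using bag_path_snoc[OF qs(1)] qs last_ps by auto
      moreover have "\<not> (qs @ [Y]) ! h \<subseteq> (qs @ [Y]) ! (h - 1)"
        if "1 \<le> h" "h < length (qs @ [Y])" for h
        using that False qs(2,8) by (cases "h = length qs") (auto simp: nth_append last_conv_nth)
      ultimately show ?thesis using qs by (intro exI[of _ "qs @ [Y]"]) auto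
    qed
  qed
qed simp

text \<open>The way back from parent functions to trees. The bags of the path are thinned out until
  no redundant one remains, the other bags are reattached, and nodes become positions in the
  resulting list, so the path is an initial segment.\<close>

lemma bags_to_nat_tree_decomposition:
  fixes Y :: "nat \<Rightarrow> 'a set"
  assumes par: "\<And>j. par j \<le> j - 1"
    and conn: "\<And>i j. i < j \<Longrightarrow> Y j \<inter> Y i \<subseteq> Y (par j)"
    and sub: "\<And>j. Y j \<subseteq> verts H" and cY: "\<And>j. card (Y j) \<le> t"
    and vc: "\<And>v. v \<in> verts H \<Longrightarrow> \<exists>j. v \<in> Y j"
    and ec: "\<And>e. e \<in> edges H \<Longrightarrow> e \<noteq> {} \<and> (\<exists>j. e \<subseteq> Y j)"
    and N: "\<And>j. N \<le> j \<Longrightarrow> Y j = {}"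
    and l: "l < N" and lp: "\<And>j. j \<le> l \<Longrightarrow> par j = j - 1"
    and ne: "(\<Union>j\<le>l. Y j) \<noteq> {}"
  shows "\<exists>(T' :: nat ugraph) X' P'. tree_decomposition H T' X' \<and> width T' X' \<le> int t - 1 \<and>
     is_path T' P' \<and> nonredundant X' P' \<and> (\<Union>i\<in>set P'. X' i) = (\<Union>j\<le>l. Y j)"
proof -
  have par': "par j < j" if "0 < j" for j using par[of j] that by simp
  define ps where "ps = map Y [0..<Suc l]"
  define rs where "rs = map Y [Suc l..<N]"
  have psn: "ps ! j = Y j" if "j \<le> l" for j
    unfolding ps_def using that by (subst nth_map) (auto simp del: upt_Suc)
  have pl: "length ps = Suc l" by (simp add: ps_def)
  have sps: "set ps = Y ` {..<Suc l}" by (auto simp: ps_def simp del: upt_Suc)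
  have bp: "bag_path ps"
    unfolding bag_path_def
  proof (intro allI impI)
    fix j i assume "j < length ps" "i < j"
    then show "ps ! j \<inter> ps ! i \<subseteq> ps ! (j - 1)"
      using conn[of i j] lp[of j] by (simp add: pl psn)
  qed
  have Ups: "\<Union> (set ps) = (\<Union>j\<le>l. Y j)" by (simp add: sps lessThan_Suc_atMost)
  obtain qs where qs: "bag_path qs" "qs \<noteq> []" "set qs \<subseteq> set ps" "\<Union> (set qs) = \<Union> (set ps)"
      "\<forall>A\<in>set ps. \<exists>B\<in>set qs. A \<subseteq> B" "hd qs \<noteq> {}"
      "\<forall>h. 1 \<le> h \<longrightarrow> h < length qs \<longrightarrow> \<not> qs ! h \<subseteq> qs ! (h - 1)"
    using bag_path_nonredundant[OF bp] ne Ups by auto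
  have "attachable (set ps) rs"
    using attachable_map[where par = par and Y = Y and k = "Suc l" and d = "N - Suc l", OF par' conn] l
    by (simp add: sps rs_def)
  \<comment> \<open>The thinned path has the same union as the old one and contains every dropped
    bag in some kept bag, so the remaining bags still attach.\<close>
  then have at: "attachable (set qs) rs"
    using attachable_mono qs(4,5) by metis
  define L where "L = qs @ rs"
  define M where "M = length L"
  have M0: "0 < M" using qs(2) by (simp add: M_def L_def)
  have "\<exists>p. p < j \<and> (\<forall>i<j. L ! j \<inter> L ! i \<subseteq> L ! p) \<and> (j < length qs \<longrightarrow> p = j - 1)"
    if "0 < j" "j < M" for j
  proof (cases "j < length qs")
    case True
    then show ?thesis
      using qs(1) that unfolding L_def bag_path_def
      by (intro exI[of _ "j - 1"]) (auto simp: nth_append)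
  next
    case False
    then show ?thesis using attachable_parent[OF at, of j] that unfolding L_def M_def by auto
  qed
  then obtain pr where pr: "\<And>j. 0 < j \<Longrightarrow> j < M \<Longrightarrow> pr j < j"
      "\<And>i j. i < j \<Longrightarrow> j < M \<Longrightarrow> L ! j \<inter> L ! i \<subseteq> L ! pr j"
      "\<And>j. 0 < j \<Longrightarrow> j < length qs \<Longrightarrow> j < M \<Longrightarrow> pr j = j - 1"
    by (metis gr_zeroI less_nat_zero_code)
  define T' where "T' = parent_tree M pr"
  define X' where "X' = (\<lambda>j. L ! j)"
  define P' where "P' = [0..<length qs]"
  have vT: "verts T' = {..<M}" by (simp add: T'_def parent_tree_def)
  have LY: "\<exists>k. L ! j = Y k" if "j < M" for j
  proof -
    have "L ! j \<in> set L" using that by (simp add: M_def)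
    also have "set L \<subseteq> range Y" using qs(3) sps by (auto simp: L_def rs_def)
    finally show ?thesis by auto
  qed
  have dom: "\<exists>j<M. Y k \<subseteq> L ! j" if "Y k \<noteq> {}" for k
  proof -
    have "k < N" using that N[of k] by (meson not_le)
    have "\<exists>B\<in>set L. Y k \<subseteq> B"
    proof (cases "k \<le> l")
      case True
      then have "Y k \<in> set ps" by (auto simp: sps)
      then show ?thesis using qs(5) by (auto simp: L_def)
    next
      case False
      then have "Y k \<in> set rs" using \<open>k < N\<close> by (auto simp: rs_def)
      then show ?thesis by (auto simp: L_def)
    qed
    then show ?thesis by (auto simp: in_set_conv_nth M_def)
  qed
  have "tree_decomposition H T' X'"
    unfolding tree_decomposition_def
  proof (intro conjI ballI allI impI)
    show "is_tree T'" unfolding T'_def using is_tree_parent_tree pr(1) M0 by blast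
    show "X' i \<subseteq> verts H" if "i \<in> verts T'" for i
      using LY[of i] sub that by (auto simp: X'_def vT)
    show "\<exists>i\<in>verts T'. v \<in> X' i" if v: "v \<in> verts H" for v
    proof -
      obtain k where "v \<in> Y k" using vc[OF v] by auto
      then show ?thesis using dom[of k] by (auto simp: vT X'_def)
    qed
    \<comment> \<open>As \<open>e\<close> is nonempty, so is the bag that contains it, and
      \<open>dom\<close> applies.\<close>
    show "\<exists>i\<in>verts T'. e \<subseteq> X' i" if e: "e \<in> edges H" for e
    proof -
      obtain k where k: "e \<subseteq> Y k" "e \<noteq> {}" using ec[OF e] by auto
      then obtain j where "j < M" "Y k \<subseteq> L ! j" using dom[of k] by auto
      then show ?thesis using k by (intro bexI[of _ j]) (auto simp: vT X'_def)
    qed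
    show "X' i \<inter> X' j \<subseteq> X' h" if "path_between T' i p j" "h \<in> set p" for i j p h
      using that parent_tree_path_bags[where Y = X', OF pr(1), of M p _ h] pr(2)
      unfolding path_between_def T'_def X'_def by blast
  qed
  moreover have "width T' X' \<le> int t - 1"
  proof -
    have "Max ((\<lambda>i. card (X' i)) ` verts T') \<le> t"
      using M0 LY cY by (subst Max_le_iff) (auto simp: vT X'_def, metis)
    then show ?thesis by (simp add: width_def)
  qed
  moreover have "is_path T' P'"
    unfolding is_path_def
  proof (intro conjI allI impI)
    fix i assume "Suc i < length P'"
    then have "pr (Suc i) = i" "Suc i < M" "P' ! i = i" "P' ! Suc i = Suc i"
      using pr(3)[of "Suc i"] by (auto simp: P'_def M_def L_def)
    then show "{P' ! i, P' ! Suc i} \<in> edges T'"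
      by (auto simp: T'_def parent_tree_def intro!: exI[of _ "Suc i"])
  qed (use qs(2) in \<open>auto simp: P'_def vT M_def L_def\<close>)
  moreover have "nonredundant X' P'"
  proof -
    have "nonredundant_start X' P'"
      using qs(2,6,7) by (auto simp: nonredundant_start_def X'_def P'_def L_def nth_append hd_conv_nth)
    then show ?thesis by (simp add: nonredundant_def)
  qed
  moreover have "(\<Union>i\<in>set P'. X' i) = (\<Union>j\<le>l. Y j)"
  proof -
    have "(\<Union>i\<in>set P'. X' i) = \<Union> (set qs)"
      by (fastforce simp: P'_def X'_def L_def nth_append in_set_conv_nth)
    then show ?thesis using qs(4) Ups by simp
  qed
  ultimately show ?thesis by blast
qed

section \<open>Arcs on a circle\<close>

text \<open>The intervals are the gaps between red points, and \<open>K \<mu> h\<close> holds the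
  red points that the shift by \<open>\<mu>\<close> moves into gap \<open>h\<close>, kept as
  integers not reduced modulo \<open>n\<close> so that arcs through \<open>0\<close> stay intervals.
  The first bound counts red points by the gap they reach; the second holds because the arcs spanned
  by the sets \<open>K \<mu> h\<close> and the gaps met by the opposite shift are disjoint.\<close>

lemma cyclic_arc_sums:
  fixes n \<mu> :: int and a b :: "'h \<Rightarrow> int"
  assumes \<mu>: "0 < \<mu>" "\<mu> < n" and Red: "Red \<subseteq> {0..<n}" and H: "finite H"
    and disj: "\<And>g h. g \<in> H \<Longrightarrow> h \<in> H \<Longrightarrow> g \<noteq> h \<Longrightarrow> {a g..b g} \<inter> {a h..b h} = {}"
    and cover: "(\<Union>h\<in>H. {a h..b h}) = {0..<n} - Red"
    and shift: "\<And>x. x \<in> Red \<Longrightarrow> (x + \<mu>) mod n \<notin> Red"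
    and K: "\<And>\<mu> h. K \<mu> h = {z \<in> {a h - \<mu>..b h - \<mu>}. z mod n \<in> Red}"
    and Hp: "\<And>\<mu>. Hp \<mu> = {h \<in> H. K \<mu> h \<noteq> {}}"
  shows "int (card Red) \<le> (\<Sum>h\<in>Hp \<mu>. int (card (K \<mu> h)))"
    and "(\<Sum>h\<in>Hp \<mu>. Max (K \<mu> h) - Min (K \<mu> h) + 1) + (\<Sum>h\<in>Hp (n - \<mu>). b h - a h + 1) \<le> n"
proof -
  have fK: "finite (K \<mu> h)" for \<mu> h
    by (rule finite_subset[of _ "{a h - \<mu>..b h - \<mu>}"]) (auto simp: K)
  have fHp: "finite (Hp \<mu>)" for \<mu> using H by (simp add: Hp)
  have "Red \<subseteq> (\<Union>h\<in>Hp \<mu>. (\<lambda>z. z mod n) ` K \<mu> h)"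
  proof
    fix x assume x: "x \<in> Red"
    then have "(x + \<mu>) mod n \<in> {0..<n} - Red" using shift \<mu> by auto
    then obtain h where h: "h \<in> H" "(x + \<mu>) mod n \<in> {a h..b h}" using cover by blast
    define z where "z = (x + \<mu>) mod n - \<mu>"
    have "z mod n = x"
      using x Red \<mu> by (auto simp: z_def mod_diff_left_eq)
    then have "z \<in> K \<mu> h" using h x by (auto simp: K z_def)
    then show "x \<in> (\<Union>h\<in>Hp \<mu>. (\<lambda>z. z mod n) ` K \<mu> h)"
      using h \<open>z mod n = x\<close> by (auto simp: Hp)
  qed
  then have "card Red \<le> card (\<Union>h\<in>Hp \<mu>. (\<lambda>z. z mod n) ` K \<mu> h)"
    using fHp fK by (intro card_mono) auto
  also have "\<dots> \<le> (\<Sum>h\<in>Hp \<mu>. card ((\<lambda>z. z mod n) ` K \<mu> h))"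
    using fHp by (rule card_UN_le)
  also have "\<dots> \<le> (\<Sum>h\<in>Hp \<mu>. card (K \<mu> h))"
    by (intro sum_mono card_image_le fK)
  finally show "int (card Red) \<le> (\<Sum>h\<in>Hp \<mu>. int (card (K \<mu> h)))"
    by (metis of_nat_le_iff of_nat_sum)

  define A where "A = (\<lambda>h. (\<lambda>z. z mod n) ` {Min (K \<mu> h)..Max (K \<mu> h)})"
  have gap: "{a h..b h} \<subseteq> {0..<n} - Red" if "h \<in> H" for h using cover that by blast
  have mm: "Min (K \<mu> h) \<in> K \<mu> h" "Max (K \<mu> h) \<in> K \<mu> h" if "h \<in> Hp \<mu>" for h
    using that fK by (auto simp: Hp)
  have ends: "a h - \<mu> \<le> Min (K \<mu> h)" "Min (K \<mu> h) \<le> Max (K \<mu> h)" "Max (K \<mu> h) \<le> b h - \<mu>"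
      "Min (K \<mu> h) mod n \<in> Red" "Max (K \<mu> h) mod n \<in> Red" "0 \<le> a h" "b h < n" if h: "h \<in> Hp \<mu>" for h
  proof -
    show "a h - \<mu> \<le> Min (K \<mu> h)" "Max (K \<mu> h) \<le> b h - \<mu>"
      "Min (K \<mu> h) mod n \<in> Red" "Max (K \<mu> h) mod n \<in> Red"
      using mm[OF h] by (auto simp: K)
    show le: "Min (K \<mu> h) \<le> Max (K \<mu> h)" using mm[OF h] fK by simp
    have "a h \<le> b h" using mm[OF h] by (auto simp: K)
    moreover have "h \<in> H" using h by (simp add: Hp)
    ultimately have "a h \<in> {a h..b h}" "b h \<in> {a h..b h}" by auto
    then show "0 \<le> a h" "b h < n" using gap[OF \<open>h \<in> H\<close>] by auto
  qed
  have cardA: "int (card (A h)) = Max (K \<mu> h) - Min (K \<mu> h) + 1" if h: "h \<in> Hp \<mu>" for h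
  proof -
    \<comment> \<open>The arc is a translate of part of a gap, hence shorter than
      \<open>n\<close>.\<close>
    have "inj_on (\<lambda>z. z mod n) {Min (K \<mu> h)..Max (K \<mu> h)}"
    proof (rule inj_onI)
      fix y z assume yz: "y \<in> {Min (K \<mu> h)..Max (K \<mu> h)}" "z \<in> {Min (K \<mu> h)..Max (K \<mu> h)}"
        and "y mod n = z mod n"
      then have "n dvd y - z" by (simp add: mod_eq_dvd_iff)
      moreover have "\<bar>y - z\<bar> < n" using yz ends[OF h] by auto
      ultimately show "y = z" using dvd_imp_le_int[of "y - z" n] \<mu> by auto
    qed
    then show ?thesis using ends[OF h] by (simp add: A_def card_image)
  qed
  have A_shift: "\<exists>z\<in>{a h..b h}. x = (z - \<mu>) mod n" if "h \<in> Hp \<mu>" "x \<in> A h" for x h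
    using that ends[of h] unfolding A_def by (force intro: bexI[of _ "_ + \<mu>"])
  have A_disj: "A g \<inter> A h = {}" if gh: "g \<in> Hp \<mu>" "h \<in> Hp \<mu>" "g \<noteq> h" for g h
  proof (rule ccontr)
    assume "A g \<inter> A h \<noteq> {}"
    then obtain y z where yz: "y \<in> {a g..b g}" "z \<in> {a h..b h}" "(y - \<mu>) mod n = (z - \<mu>) mod n"
      using A_shift gh by (metis disjoint_iff)
    then have "n dvd y - z" by (simp add: mod_eq_dvd_iff)
    moreover have "\<bar>y - z\<bar> < n" using yz ends[OF gh(1)] ends[OF gh(2)] by auto
    ultimately have "y = z" using dvd_imp_le_int[of "y - z" n] \<mu> by auto
    then show False using yz disj[of g h] gh by (auto simp: Hp)
  qed
  \<comment> \<open>An arc with red ends that meets gap \<open>g\<close> contains all of it strictly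
    inside. A red point that the opposite shift moves into \<open>g\<close> would then, moved
    forward by \<open>\<mu>\<close>, lie in gap \<open>h\<close>, which has no red points.\<close>
  have AB_disj: "A h \<inter> {a g..b g} = {}" if h: "h \<in> Hp \<mu>" and g: "g \<in> Hp (n - \<mu>)" for g h
  proof (rule ccontr)
    assume "A h \<inter> {a g..b g} \<noteq> {}"
    then obtain z where z: "Min (K \<mu> h) \<le> z" "z \<le> Max (K \<mu> h)" "a g \<le> z mod n" "z mod n \<le> b g"
      by (auto simp: A_def)
    \<comment> \<open>The multiple of \<open>n\<close> that carries gap \<open>g\<close> to its copy
      containing \<open>z\<close>.\<close>
    define d where "d = z - z mod n"
    have d: "(x + d) mod n = x mod n" for x
      by (simp add: d_def minus_mod_eq_mult_div)
    have gH: "g \<in> H" and hH: "h \<in> H" using g h by (auto simp: Hp)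
    have nr: "w mod n \<notin> Red" if "a g + d \<le> w" "w \<le> b g + d" for w
    proof -
      have "w - d \<in> {a g..b g}" using that by simp
      then have "w - d \<in> {0..<n} - Red" using gap[OF gH] by blast
      moreover have "w mod n = (w - d) mod n" using d[of "w - d"] by simp
      ultimately show ?thesis by simp
    qed
    have "Min (K \<mu> h) < a g + d"
      using nr[of "Min (K \<mu> h)"] ends[OF h] z by (force simp: d_def)
    moreover have "b g + d < Max (K \<mu> h)"
      using nr[of "Max (K \<mu> h)"] ends[OF h] z by (force simp: d_def)
    moreover obtain y where y: "a g - (n - \<mu>) \<le> y" "y \<le> b g - (n - \<mu>)" "y mod n \<in> Red"
      using g by (auto simp: Hp K)
    ultimately have "y + n + d \<in> {a h..b h}" using ends[OF h] by auto
    then have "y + n + d \<in> {0..<n} - Red" using gap[OF hH] by blast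
    moreover have "(y + n + d) mod n = y mod n" using d[of "y + n"] by simp
    ultimately show False using y by auto
  qed
  have "(\<Sum>h\<in>Hp \<mu>. Max (K \<mu> h) - Min (K \<mu> h) + 1) + (\<Sum>h\<in>Hp (n - \<mu>). b h - a h + 1)
      = (\<Sum>h\<in>Hp \<mu>. int (card (A h))) + (\<Sum>h\<in>Hp (n - \<mu>). int (card {a h..b h}))"
  proof -
    have "a h \<le> b h" if "h \<in> Hp (n - \<mu>)" for h using that by (auto simp: Hp K)
    then show ?thesis using cardA by simp
  qed
  also have "(\<Sum>h\<in>Hp \<mu>. int (card (A h))) = int (card (\<Union>h\<in>Hp \<mu>. A h))"
    using A_disj fHp by (subst card_UN_disjoint) (auto simp: A_def)
  also have "(\<Sum>h\<in>Hp (n - \<mu>). int (card {a h..b h})) = int (card (\<Union>h\<in>Hp (n - \<mu>). {a h..b h}))"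
    using disj fHp by (subst card_UN_disjoint) (auto simp: Hp)
  also have "int (card (\<Union>h\<in>Hp \<mu>. A h)) + int (card (\<Union>h\<in>Hp (n - \<mu>). {a h..b h}))
      = int (card ((\<Union>h\<in>Hp \<mu>. A h) \<union> (\<Union>h\<in>Hp (n - \<mu>). {a h..b h})))"
    using AB_disj fHp by (subst card_Un_disjoint) (auto simp: A_def)
  also have "\<dots> \<le> int (card {0..<n})"
  proof -
    have "(\<Union>h\<in>Hp \<mu>. A h) \<union> (\<Union>h\<in>Hp (n - \<mu>). {a h..b h}) \<subseteq> {0..<n}"
      using \<mu> cover by (auto simp: A_def Hp)
    then show ?thesis by (simp add: card_mono del: card_atLeastLessThan_int)
  qed
  also have "\<dots> = n" using \<mu> by simp
  finally show "(\<Sum>h\<in>Hp \<mu>. Max (K \<mu> h) - Min (K \<mu> h) + 1)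
      + (\<Sum>h\<in>Hp (n - \<mu>). b h - a h + 1) \<le> n" .
qed

text \<open>Averaging over both shifts and all gaps they meet. The total of gap and arc lengths is
  at most \<open>2 * n\<close>, and each shift accounts for all red points.\<close>

lemma dense_cyclic_arc:
  fixes n m :: int and a b :: "'h \<Rightarrow> int"
  assumes m: "0 < m" "m < n" and Red: "Red \<subseteq> {0..<n}" "Red \<noteq> {}" and H: "finite H"
    and disj: "\<And>g h. g \<in> H \<Longrightarrow> h \<in> H \<Longrightarrow> g \<noteq> h \<Longrightarrow> {a g..b g} \<inter> {a h..b h} = {}"
    and cover: "(\<Union>h\<in>H. {a h..b h}) = {0..<n} - Red"
    and shift: "\<And>x. x \<in> Red \<Longrightarrow> (x + m) mod n \<notin> Red"
  shows "\<exists>h\<in>H. \<exists>\<mu>\<in>{m, n - m}. \<exists>x y. x \<le> y \<and> a h - \<mu> \<le> x \<and> y \<le> b h - \<mu> \<and>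
    x mod n \<in> Red \<and> y mod n \<in> Red \<and>
    int (card Red) * ((b h - a h + 1) + (y - x + 1)) \<le> n * int (card {z \<in> {x..y}. z mod n \<in> Red})"
proof -
  define K where "K = (\<lambda>\<mu> h. {z \<in> {a h - \<mu>..b h - \<mu>}. z mod n \<in> Red})"
  define Hp where "Hp = (\<lambda>\<mu>. {h \<in> H. K \<mu> h \<noteq> {}})"
  define len where "len = (\<lambda>\<mu> h. Max (K \<mu> h) - Min (K \<mu> h) + 1)"
  define k where "k = (\<lambda>\<mu> h. int (card (K \<mu> h)))"
  define S where "S = (\<lambda>h. b h - a h + 1)"
  define r where "r = int (card Red)"
  have fin: "finite Red" using Red(1) finite_subset by blast
  have r0: "0 < r" using Red fin by (simp add: r_def card_gt_0_iff)
  have fHp: "finite (Hp \<mu>)" for \<mu> using H by (simp add: Hp_def)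
  have shift': "(x + (n - m)) mod n \<notin> Red" if x: "x \<in> Red" for x
  proof
    assume y: "(x + (n - m)) mod n \<in> Red"
    have "((x + (n - m)) mod n + m) mod n = (x + n) mod n"
      by (simp add: mod_add_left_eq)
    also have "\<dots> = x" using x Red by auto
    finally show False using shift[OF y] x by simp
  qed
  have sums1: "r \<le> sum (k \<mu>) (Hp \<mu>)" "sum (len \<mu>) (Hp \<mu>) + sum S (Hp (n - \<mu>)) \<le> n"
    if "0 < \<mu>" "\<mu> < n" "\<And>x. x \<in> Red \<Longrightarrow> (x + \<mu>) mod n \<notin> Red" for \<mu>
    using cyclic_arc_sums[where K = K and Hp = Hp, OF that(1,2) Red(1) H _ cover] disj that(3)
    unfolding r_def k_def len_def S_def by (simp_all add: K_def Hp_def)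
  have sums: "r \<le> sum (k m) (Hp m)" "sum (len m) (Hp m) + sum S (Hp (n - m)) \<le> n"
      "r \<le> sum (k (n - m)) (Hp (n - m))" "sum (len (n - m)) (Hp (n - m)) + sum S (Hp m) \<le> n"
    using sums1[of m] sums1[of "n - m"] m shift shift' by simp_all
  have "\<exists>\<mu>\<in>{m, n - m}. \<exists>h\<in>Hp \<mu>. r * (S h + len \<mu> h) \<le> n * k \<mu> h"
  proof (rule ccontr)
    assume "\<not> ?thesis"
    then have lt: "n * k \<mu> h < r * (S h + len \<mu> h)" if "\<mu> \<in> {m, n - m}" "h \<in> Hp \<mu>" for \<mu> h
      using that by (meson not_le)
    \<comment> \<open>Each bound from the previous lemma pairs the arcs of one shift with the gaps
      of the other, so the contradiction comes only after adding the two shifts.\<close>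
    have "n * r < r * (sum S (Hp \<mu>) + sum (len \<mu>) (Hp \<mu>))"
      if \<mu>: "\<mu> \<in> {m, n - m}" and r: "r \<le> sum (k \<mu>) (Hp \<mu>)" for \<mu>
    proof -
      have "Hp \<mu> \<noteq> {}" using r r0 by auto
      have "n * r \<le> n * sum (k \<mu>) (Hp \<mu>)" using r m by simp
      also have "\<dots> = (\<Sum>h\<in>Hp \<mu>. n * k \<mu> h)" by (simp add: sum_distrib_left)
      also have "\<dots> < (\<Sum>h\<in>Hp \<mu>. r * (S h + len \<mu> h))"
        using \<open>Hp \<mu> \<noteq> {}\<close> fHp lt[OF \<mu>] by (intro sum_strict_mono) auto
      finally show ?thesis by (simp add: sum_distrib_left[symmetric] sum.distrib)
    qed
    from this[of m] this[of "n - m"] sums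
    have "n * r + n * r < r * (sum S (Hp m) + sum (len m) (Hp m)
        + (sum S (Hp (n - m)) + sum (len (n - m)) (Hp (n - m))))"
      by (simp add: distrib_left)
    also have "\<dots> \<le> r * (n + n)" using sums r0 by (intro mult_left_mono) auto
    finally show False by (simp add: algebra_simps)
  qed
  then obtain \<mu> h where \<mu>: "\<mu> \<in> {m, n - m}" and h: "h \<in> Hp \<mu>"
    and le: "r * (S h + len \<mu> h) \<le> n * k \<mu> h" by blast
  define x where "x = Min (K \<mu> h)"
  define y where "y = Max (K \<mu> h)"
  have fK: "finite (K \<mu> h)"
    by (rule finite_subset[of _ "{a h - \<mu>..b h - \<mu>}"]) (auto simp: K_def)
  have xy: "x \<in> K \<mu> h" "y \<in> K \<mu> h"
    using fK h by (auto simp: x_def y_def Hp_def)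
  have bd: "x \<le> z \<and> z \<le> y" if "z \<in> K \<mu> h" for z using that fK by (auto simp: x_def y_def)
  have "{z \<in> {x..y}. z mod n \<in> Red} = K \<mu> h"
    using xy bd by (auto simp: K_def)
  then show ?thesis
    using \<mu> h le xy bd[OF xy(1)] unfolding r_def S_def len_def k_def
    by (intro bexI[of _ h] bexI[of _ \<mu>] exI[of _ x] exI[of _ y])
       (auto simp: K_def x_def y_def Hp_def)
qed

section \<open>Balanced bags and approximate cuts\<close>

definition incident_edges :: "'a ugraph \<Rightarrow> 'a set \<Rightarrow> 'a set set" where
  "incident_edges G U = {e \<in> edges G. e \<inter> U \<noteq> {}}"

lemma finite_edges: "simple_graph G \<Longrightarrow> finite (edges G)"
  by (rule finite_subset[of _ "Pow (verts G)"]) (auto simp: simple_graph_def)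

lemma card_incident_edges:
  assumes "simple_graph G" "U \<subseteq> verts G"
  shows "card (incident_edges G U) \<le> card U * max_degree G"
proof -
  have fV: "finite (verts G)" using assms by (simp add: simple_graph_def)
  then have fU: "finite U" using assms finite_subset by blast
  have "incident_edges G U = (\<Union>v\<in>U. {e \<in> edges G. v \<in> e})"
    by (auto simp: incident_edges_def)
  then have "card (incident_edges G U) \<le> (\<Sum>v\<in>U. degree G v)"
    using card_UN_le[OF fU, of "\<lambda>v. {e \<in> edges G. v \<in> e}"] by (simp add: degree_def)
  also have "\<dots> \<le> (\<Sum>v\<in>U. max_degree G)"
    using fV assms by (intro sum_mono) (auto simp: max_degree_def intro!: Max_ge)
  finally show ?thesis by simp
qed

text \<open>Whole classes are collected until the next one, \<open>\<kappa>\<close>, would reach or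
  pass the target \<open>c\<close>.\<close>

lemma greedy_classes:
  assumes S: "finite S" "c \<le> card S" "S \<noteq> {}"
  shows "\<exists>U \<kappa>. \<kappa> \<notin> U \<and> card {v \<in> S. f v \<in> U} \<le> c \<and>
    c \<le> card {v \<in> S. f v \<in> U} + card {v \<in> S. f v = \<kappa>}"
proof -
  have *: "finite F \<Longrightarrow> F \<noteq> {} \<Longrightarrow> c \<le> card {v \<in> S. f v \<in> F} \<Longrightarrow> ?thesis" for F
  proof (induction F rule: finite_ne_induct)
    case (singleton k)
    then show ?case by (intro exI[of _ "{}"] exI[of _ k]) simp
  next
    case (insert k F)
    show ?case
    proof (cases "c \<le> card {v \<in> S. f v \<in> F}")
      case True
      then show ?thesis by (rule insert.IH)
    next
      case False
      have "{v \<in> S. f v \<in> insert k F} = {v \<in> S. f v \<in> F} \<union> {v \<in> S. f v = k}" by auto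
      then have "card {v \<in> S. f v \<in> insert k F} \<le> card {v \<in> S. f v \<in> F} + card {v \<in> S. f v = k}"
        by (simp add: card_Un_le)
      then show ?thesis using False insert by (intro exI[of _ F] exI[of _ k]) simp
    qed
  qed
  have "{v \<in> S. f v \<in> f ` S} = S" by auto
  then show ?thesis using *[of "f ` S"] S by simp
qed

text \<open>A rooted tree decomposition with nodes \<open>0, 1, 2, \<dots>\<close>, parents preceding their children;
  all but finitely many bags are empty.\<close>

locale bag_tree =
  fixes G :: "'a ugraph" and Y :: "nat \<Rightarrow> 'a set" and par :: "nat \<Rightarrow> nat" and t :: nat
  assumes simple: "simple_graph G"
    and par_le: "par j \<le> j - 1"
    and bag_par: "i < j \<Longrightarrow> Y j \<inter> Y i \<subseteq> Y (par j)"
    and bag_sub: "Y j \<subseteq> verts G"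
    and card_bag: "card (Y j) \<le> t"
    and vert_bag: "v \<in> verts G \<Longrightarrow> \<exists>j. v \<in> Y j"
    and edge_bag: "e \<in> edges G \<Longrightarrow> \<exists>j. e \<subseteq> Y j"
begin

text \<open>Parents have smaller indices, so the least index is the node nearest the root among
  those whose bags contain \<open>v\<close>.\<close>

definition top_bag :: "'a \<Rightarrow> nat" where
  "top_bag v = (LEAST j. v \<in> Y j)"

lemma top_bag_le: "v \<in> Y j \<Longrightarrow> top_bag v \<le> j"
  unfolding top_bag_def by (rule Least_le)

lemma top_bag_in: "v \<in> verts G \<Longrightarrow> v \<in> Y (top_bag v)"
  unfolding top_bag_def using vert_bag by (rule LeastI_ex)

lemma bag_parI:
  assumes "u \<in> Y j" "top_bag u < j"
  shows "u \<in> Y (par j)"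
proof -
  have "u \<in> Y (top_bag u)" using assms bag_sub top_bag_in by blast
  then show ?thesis using bag_par[OF assms(2)] assms(1) by blast
qed

lemma par_less: "0 < j \<Longrightarrow> par j < j"
  using par_le[of j] by simp

lemma finite_verts: "finite (verts G)"
  using simple by (simp add: simple_graph_def)

text \<open>Climb from a bag containing both ends: neither end is lost before the topmost bag of the
  later one is reached, so that bag contains both.\<close>

lemma edgeE:
  assumes "e \<in> edges G"
  obtains u v where "e = {u, v}" "u \<noteq> v" "u \<in> verts G" "v \<in> verts G" "u \<in> Y (top_bag v)"
    "top_bag u \<le> top_bag v"
proof -
  obtain a b where ab: "e = {a, b}" "a \<noteq> b"
    using simple assms by (auto simp: simple_graph_def card_2_iff)
  have V: "a \<in> verts G" "b \<in> verts G" using simple assms ab by (auto simp: simple_graph_def)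
  have up: "u \<in> Y k \<Longrightarrow> v \<in> Y k \<Longrightarrow> top_bag u \<le> top_bag v \<Longrightarrow> u \<in> Y (top_bag v)" for u v k
  proof (induction k rule: less_induct)
    case (less k)
    show ?case
    proof (cases "top_bag v = k")
      case True
      then show ?thesis using less.prems by simp
    next
      case False
      then have "top_bag v < k" using top_bag_le[of v k] less.prems by simp
      then show ?thesis
        using less.IH[of "par k"] par_less[of k] bag_parI[of v k] bag_parI[of u k] less.prems by auto
    qed
  qed
  obtain k where k: "a \<in> Y k" "b \<in> Y k" using edge_bag[OF assms] ab by auto
  show ?thesis
  proof (cases "top_bag a \<le> top_bag b")
    case True
    then show ?thesis using that[of a b] ab V up k by blast
  next
    case False
    then show ?thesis using that[of b a] ab V up[of b k a] k by (auto simp: insert_commute)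
  qed
qed

lemma card_incident_bag: "card (incident_edges G (Y j)) \<le> t * max_degree G"
  using card_incident_edges[OF simple bag_sub, of j] card_bag[of j] mult_le_mono1 order_trans by blast

section \<open>Ancestors, and the components left by deleting a node\<close>

definition below :: "nat \<Rightarrow> nat \<Rightarrow> bool" where
  "below i j \<longleftrightarrow> (\<lambda>a b. b = par a)\<^sup>*\<^sup>* j i"

lemma below_iff: "below i j \<longleftrightarrow> j = i \<or> below i (par j)"
  unfolding below_def by (auto elim: converse_rtranclpE intro: converse_rtranclp_into_rtranclp)

lemma below_root: "below 0 j"
proof (induction j rule: less_induct)
  case (less j)
  then show ?case using below_iff[of 0 j] par_less[of j] by (cases "j = 0") auto
qed

lemma below_le: "below i j \<Longrightarrow> i \<le> j"
proof (induction j rule: less_induct)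
  case (less j)
  show ?case
  proof (cases "j = 0")
    case True
    have "par 0 = 0" using par_le[of 0] by simp
    have "(\<lambda>a b. b = par a)\<^sup>*\<^sup>* 0 k \<Longrightarrow> k = 0" for k
      by (induction rule: rtranclp_induct) (simp_all add: \<open>par 0 = 0\<close>)
    then show ?thesis using less.prems True by (simp add: below_def)
  next
    case False
    then show ?thesis using less below_iff[of i j] par_less[of j] by fastforce
  qed
qed

text \<open>A name for the component of \<open>j\<close> after deleting node \<open>i\<close>: the
  set holding the child of \<open>i\<close> above or equal to \<open>j\<close>, and the empty set
  when \<open>j\<close> is not strictly below \<open>i\<close>.\<close>

definition branches :: "nat \<Rightarrow> nat \<Rightarrow> nat set" where
  "branches i j = {d. i < d \<and> par d = i \<and> below d j}"

lemma branches_empty_below: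
  "below i j \<Longrightarrow> branches i j = {} \<Longrightarrow> j = i"
proof (induction j rule: less_induct)
  case (less j)
  show ?case
  proof (rule ccontr)
    assume "j \<noteq> i"
    then have b: "below i (par j)" "i < j" using less.prems below_iff[of i j] below_le[of i j] by auto
    have sub: "branches i (par j) \<subseteq> branches i j"
      using below_iff[of _ j] by (auto simp: branches_def)
    then have "par j = i" using less.IH[of "par j"] par_less[of j] b less.prems by auto
    then have "j \<in> branches i j" using b below_iff[of j j] by (simp add: branches_def)
    then show False using less.prems by simp
  qed
qed

text \<open>Climbing from \<open>j\<close> to the topmost bag of \<open>u\<close> stays in bags
  containing \<open>u\<close>, hence never passes \<open>i\<close> and never changes the
  component.\<close>

lemma branches_bag:
  "u \<in> Y j \<Longrightarrow> u \<notin> Y i \<Longrightarrow> branches i j = branches i (top_bag u)"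
proof (induction j rule: less_induct)
  case (less j)
  show ?case
  proof (cases "top_bag u = j")
    case False
    then have lt: "top_bag u < j" using less.prems top_bag_le[of u j] by simp
    then have up: "u \<in> Y (par j)" using less.prems bag_parI by blast
    then have "par j \<noteq> i" using less.prems by auto
    then have "branches i j = branches i (par j)"
      using below_iff[of _ j] by (auto simp: branches_def)
    then show ?thesis using less.IH[of "par j"] up less.prems par_less lt by auto
  qed simp
qed

text \<open>The separating bag is the last one whose subtree contains the top bags of more than half
  of \<open>S\<close>.\<close>

lemma balanced_bag:
  assumes S: "S \<subseteq> verts G" "S \<noteq> {}"
  obtains i where
    "\<And>e. e \<in> edges G \<Longrightarrow> e \<inter> Y i = {} \<Longrightarrow> \<exists>c. \<forall>v\<in>e. branches i (top_bag v) = c"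
    "\<And>c. 2 * card {v \<in> S - Y i. branches i (top_bag v) = c} \<le> card S"
proof -
  have fS: "finite S" using S finite_verts finite_subset by blast
  define w where "w = (\<lambda>i. card {v \<in> S. below i (top_bag v)})"
  define heavy where "heavy = {i. card S < 2 * w i}"
  have "w 0 = card S" by (simp add: w_def below_root)
  then have h0: "0 \<in> heavy" using S fS by (simp add: heavy_def card_gt_0_iff)
  have "heavy \<subseteq> {..Max (top_bag ` S)}"
  proof
    fix i assume "i \<in> heavy"
    then have "w i \<noteq> 0" by (auto simp: heavy_def)
    then have "{v \<in> S. below i (top_bag v)} \<noteq> {}" unfolding w_def by (metis card.empty)
    then obtain v where "v \<in> S" "i \<le> top_bag v" using below_le by blast
    then show "i \<in> {..Max (top_bag ` S)}" using fS by (auto intro: order_trans Max_ge)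
  qed
  then have fh: "finite heavy" using finite_subset by blast
  define i where "i = Max heavy"
  have ih: "i \<in> heavy" unfolding i_def using h0 by (intro Max_in[OF fh]) auto
  have light: "2 * w d \<le> card S" if "i < d" for d
  proof -
    have "d \<notin> heavy" using Max_ge[OF fh, of d] that by (auto simp: i_def)
    then show ?thesis by (simp add: heavy_def)
  qed
  show ?thesis
  proof (rule that[of i])
    fix e assume e: "e \<in> edges G" "e \<inter> Y i = {}"
    then obtain u v where "e = {u, v}" "u \<in> Y (top_bag v)" using edgeE by blast
    then show "\<exists>c. \<forall>v\<in>e. branches i (top_bag v) = c"
      using branches_bag[of u "top_bag v" i] e by auto
  next
    fix c
    let ?A = "{v \<in> S - Y i. branches i (top_bag v) = c}"
    show "2 * card ?A \<le> card S"
    proof (cases "c = {}")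
      case True
      \<comment> \<open>A topmost bag below \<open>i\<close> without a branch is \<open>Y i\<close>
        itself, so these vertices lie outside the subtree of \<open>i\<close>, which holds more than
        half of \<open>S\<close>.\<close>
      have "?A \<subseteq> S - {v \<in> S. below i (top_bag v)}"
        using True branches_empty_below[of i] top_bag_in S by blast
      then have "card ?A \<le> card S - w i"
        unfolding w_def using fS by (subst card_Diff_subset[symmetric]) (auto intro!: card_mono)
      then show ?thesis using ih by (simp add: heavy_def)
    next
      case False
      \<comment> \<open>If the class is nonempty, its topmost bags all lie below
        \<open>d > i\<close>, and \<open>d\<close> is not heavy because \<open>i\<close> is the
        largest heavy index.\<close>
      then obtain d where d: "d \<in> c" by blast
      show ?thesis
      proof (cases "?A = {}")
        case False
        then have "i < d" using d by (auto simp: branches_def)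
        moreover have "?A \<subseteq> {v \<in> S. below d (top_bag v)}" using d by (auto simp: branches_def)
        then have "card ?A \<le> w d" unfolding w_def using fS by (intro card_mono) auto
        ultimately show ?thesis using light[of d] by simp
      next
        case True
        then have "card ?A = 0" by (metis card.empty)
        then show ?thesis by simp
      qed
    qed
  qed
qed

section \<open>Cutting off a prescribed number of vertices\<close>

definition crossing :: "'a set \<Rightarrow> 'a set \<Rightarrow> 'a set set" where
  "crossing S C = {e \<in> edges G. e \<subseteq> S \<and> e \<inter> C \<noteq> {} \<and> e - C \<noteq> {}}"

lemma finite_crossing: "finite (crossing S C)"
  using finite_edges[OF simple] by (simp add: crossing_def)

text \<open>Halving: a balanced bag splits \<open>S\<close> into classes, whole classes are taken
  greedily, and the recursion continues inside the one class that is split. Each level costs the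
  edges at one bag; once \<open>card S \<le> s\<close> the empty set is accurate enough.\<close>

lemma approximate_cut:
  assumes s: "1 \<le> s"
  shows "S \<subseteq> verts G \<Longrightarrow> card S \<le> 2 ^ q * s \<Longrightarrow> c \<le> card S \<Longrightarrow>
    \<exists>C\<subseteq>S. card C \<le> c \<and> c \<le> card C + s \<and> card (crossing S C) \<le> q * (t * max_degree G)"
proof (induction q arbitrary: S c)
  case 0
  then show ?case by (intro exI[of _ "{}"]) (auto simp: crossing_def)
next
  case (Suc q)
  have fS: "finite S" using Suc.prems finite_verts finite_subset by blast
  show ?case
  proof (cases "S = {}")
    case True
    then show ?thesis using Suc.prems by (intro exI[of _ "{}"]) (auto simp: crossing_def)
  next
    case False
    obtain i where i: "\<And>e. e \<in> edges G \<Longrightarrow> e \<inter> Y i = {} \<Longrightarrow> \<exists>c. \<forall>v\<in>e. branches i (top_bag v) = c"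
      "\<And>c. 2 * card {v \<in> S - Y i. branches i (top_bag v) = c} \<le> card S"
      using balanced_bag[OF Suc.prems(1) False] by metis
    \<comment> \<open>Vertices of the bag form singleton classes, the others are grouped by
      component. The two coordinates keep both kinds of names apart.\<close>
    define f where "f = (\<lambda>v. if v \<in> Y i then ({v}, {}) else ({}, branches i (top_bag v)))"
    obtain U \<kappa> where U: "\<kappa> \<notin> U" "card {v \<in> S. f v \<in> U} \<le> c"
      "c \<le> card {v \<in> S. f v \<in> U} + card {v \<in> S. f v = \<kappa>}"
      using greedy_classes[OF fS Suc.prems(3) False, of f] by blast
    define C0 where "C0 = {v \<in> S. f v \<in> U}"
    define D where "D = {v \<in> S. f v = \<kappa>}"
    have D: "D \<subseteq> S" "card D \<le> 2 ^ q * s"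
    proof -
      show "D \<subseteq> S" by (auto simp: D_def)
      show "card D \<le> 2 ^ q * s"
      proof (cases "\<exists>v. fst \<kappa> = {v}")
        case True
        then obtain v where "D \<subseteq> {v}" by (fastforce simp: D_def f_def split: if_splits)
        then have "card D \<le> 1" using card_mono[of "{v}" D] by simp
        also have "1 \<le> 2 ^ q * s" using s by simp
        finally show ?thesis .
      next
        case False
        then have "D \<subseteq> {v \<in> S - Y i. branches i (top_bag v) = snd \<kappa>}"
          by (force simp: D_def f_def split: if_splits)
        then have "card D \<le> card {v \<in> S - Y i. branches i (top_bag v) = snd \<kappa>}"
          using fS by (intro card_mono) auto
        then show ?thesis using i(2)[of "snd \<kappa>"] Suc.prems(2) by simp
      qed
    qed
    have "c - card C0 \<le> card D" using U by (simp add: C0_def D_def)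
    then obtain C1 where C1: "C1 \<subseteq> D" "card C1 \<le> c - card C0" "c - card C0 \<le> card C1 + s"
      "card (crossing D C1) \<le> q * (t * max_degree G)"
      using Suc.IH[OF order_trans[OF D(1) Suc.prems(1)] D(2)] by blast
    have disj: "C0 \<inter> D = {}" using U(1) by (auto simp: C0_def D_def)
    have fin: "finite C0" "finite C1"
      using fS D(1) C1(1) by (auto simp: C0_def intro: finite_subset)
    have cardC: "card (C0 \<union> C1) = card C0 + card C1"
      using disj C1(1) fin by (intro card_Un_disjoint) auto
    have "crossing S (C0 \<union> C1) \<subseteq> incident_edges G (Y i) \<union> crossing D C1"
    proof
      fix e assume e: "e \<in> crossing S (C0 \<union> C1)"
      show "e \<in> incident_edges G (Y i) \<union> crossing D C1"
      proof (cases "e \<inter> Y i = {}")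
        case True
        have eS: "e \<in> edges G" "e \<subseteq> S" "e \<inter> (C0 \<union> C1) \<noteq> {}" "e - (C0 \<union> C1) \<noteq> {}"
          using e by (auto simp: crossing_def)
        \<comment> \<open>An edge avoiding \<open>Y i\<close> lies in one class. Classes other than
          \<open>\<kappa>\<close> are taken whole or left out, so only edges inside \<open>D\<close>
          can still be cut.\<close>
        obtain k where "\<forall>v\<in>e. branches i (top_bag v) = k" using i(1)[OF eS(1) True] by blast
        then have k: "\<forall>v\<in>e. f v = ({}, k)" using True by (auto simp: f_def)
        have "e \<subseteq> D"
        proof (rule ccontr)
          assume "\<not> e \<subseteq> D"
          then have "({}, k) \<noteq> \<kappa>" using k eS(2) by (auto simp: D_def)
          then have "e \<inter> C1 = {}" using k C1(1) by (auto simp: D_def)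
          then have "e \<inter> C0 \<noteq> {}" using eS(3) by blast
          then have "({}, k) \<in> U" using k by (auto simp: C0_def)
          then have "e \<subseteq> C0" using k eS(2) by (auto simp: C0_def)
          then show False using eS(4) by blast
        qed
        then have "e \<inter> C0 = {}" using disj by blast
        then show ?thesis using eS \<open>e \<subseteq> D\<close> by (auto simp: crossing_def)
      next
        case False
        then show ?thesis using e by (auto simp: crossing_def incident_edges_def)
      qed
    qed
    then have "card (crossing S (C0 \<union> C1)) \<le> card (incident_edges G (Y i) \<union> crossing D C1)"
      using finite_crossing finite_edges[OF simple]
      by (intro card_mono) (auto simp: incident_edges_def)
    also have "\<dots> \<le> card (incident_edges G (Y i)) + card (crossing D C1)" by (rule card_Un_le)
    also have "\<dots> \<le> Suc q * (t * max_degree G)"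
      using card_incident_bag[of i] C1(4) by simp
    finally have "card (crossing S (C0 \<union> C1)) \<le> Suc q * (t * max_degree G)" .
    moreover have "C0 \<union> C1 \<subseteq> S" using C1(1) D(1) by (auto simp: C0_def)
    moreover have "card (C0 \<union> C1) \<le> c" "c \<le> card (C0 \<union> C1) + s"
      using cardC C1 U by (auto simp: C0_def)
    ultimately show ?thesis by blast
  qed
qed

end

section \<open>Vertices along a path of bags\<close>

text \<open>The label is the position in a list sorted by \<open>key\<close>; integers are used
  because labels are later shifted around the circle.\<close>

lemma sorted_labelling:
  fixes key :: "'a \<Rightarrow> nat"
  assumes "finite V"
  obtains lab :: "'a \<Rightarrow> int" where "bij_betw lab V {0..<int (card V)}"
    "\<And>u v. u \<in> V \<Longrightarrow> v \<in> V \<Longrightarrow> key u < key v \<Longrightarrow> lab u < lab v"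
proof -
  obtain ys where ys: "set ys = V" "distinct ys" using finite_distinct_list[OF assms] by blast
  define xs where "xs = sort_key key ys"
  have xs: "set xs = V" "distinct xs" "sorted (map key xs)" using ys by (simp_all add: xs_def)
  have len: "length xs = card V" using xs distinct_card by fastforce
  have bij: "bij_betw ((!) xs) {..<card V} V"
    using bij_betw_nth[OF xs(2)] len xs(1) by metis
  define pos where "pos = the_inv_into {..<card V} ((!) xs)"
  have bp: "bij_betw pos V {..<card V}"
    unfolding pos_def using bij by (rule bij_betw_the_inv_into)
  have nth: "xs ! pos v = v" if "v \<in> V" for v
    unfolding pos_def using bij that by (simp add: bij_betw_def f_the_inv_into_f)
  have "bij_betw int {..<card V} {0..<int (card V)}"
    by (rule bij_betw_byWitness[where f' = nat]) auto
  then have "bij_betw (int \<circ> pos) V {0..<int (card V)}" using bp bij_betw_trans by blast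
  moreover have "(int \<circ> pos) u < (int \<circ> pos) v" if uv: "u \<in> V" "v \<in> V" "key u < key v" for u v
  proof (rule ccontr)
    assume "\<not> ?thesis"
    then have "pos v \<le> pos u" by simp
    moreover have "pos u < length xs" using bp uv len by (auto simp: bij_betw_def)
    ultimately have "key (xs ! pos v) \<le> key (xs ! pos u)"
      using xs(3) sorted_nth_mono[of "map key xs" "pos v" "pos u"] by simp
    then show False using nth uv by simp
  qed
  ultimately show ?thesis using that by blast
qed

locale bag_tree_path = bag_tree +
  fixes l :: nat
  assumes par_path: "j \<le> l \<Longrightarrow> par j = j - 1"
begin

text \<open>Deleting the edges of the path \<open>0, \<dots>, l\<close> splits the tree into subtrees, one for each
  path node; \<open>block j\<close> is the path node in the subtree of \<open>j\<close>.\<close>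

function block :: "nat \<Rightarrow> nat" where
  "block j = (if j \<le> l then j else block (par j))"
  by auto
termination by (relation "measure id") (auto intro!: par_less)

declare block.simps [simp del]

lemma block_path: "j \<le> l \<Longrightarrow> block j = j"
  by (simp add: block.simps)

lemma block_le: "block j \<le> l"
proof (induction j rule: less_induct)
  case (less j)
  then show ?case using block.simps[of j] par_less[of j] by (cases "j \<le> l") auto
qed

text \<open>Climb from \<open>j\<close>: either the topmost bag of \<open>u\<close> is met before
  the path, in the same subtree, or \<open>u\<close> is still present when the path is
  reached.\<close>

lemma bag_block:
  "u \<in> Y j \<Longrightarrow> (l < top_bag u \<and> block (top_bag u) = block j) \<or>
    (top_bag u \<le> l \<and> top_bag u \<le> block j \<and> u \<in> Y (block j))"
proof (induction j rule: less_induct)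
  case (less j)
  have le: "top_bag u \<le> j" using less.prems by (rule top_bag_le)
  show ?case
  proof (cases "j \<le> l")
    case True
    then show ?thesis using le less.prems by (simp add: block_path)
  next
    case False
    then have bj: "block j = block (par j)" by (simp add: block.simps)
    show ?thesis
    proof (cases "top_bag u = j")
      case True
      then show ?thesis using False by simp
    next
      case neq: False
      then have "u \<in> Y (par j)" using le less.prems bag_parI by simp
      then show ?thesis using less.IH[of "par j"] par_less[of j] False bj by simp
    qed
  qed
qed

lemma path_bag_between:
  "u \<in> Y h \<Longrightarrow> h \<le> l \<Longrightarrow> top_bag u \<le> g \<Longrightarrow> g \<le> h \<Longrightarrow> u \<in> Y g"
proof (induction h)
  case (Suc h)
  show ?case
  proof (cases "g = Suc h")
    case False
    then have "u \<in> Y h" using bag_parI[of u "Suc h"] Suc.prems par_path[of "Suc h"] by simp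
    then show ?thesis using Suc False by simp
  qed (use Suc in simp)
qed simp

section \<open>The linear order of the vertices along the path\<close>

definition blk :: "'a \<Rightarrow> nat" where
  "blk v = block (top_bag v)"

definition path_verts :: "'a set" where
  "path_verts = {v \<in> verts G. top_bag v \<le> l}"

definition hanging :: "nat \<Rightarrow> 'a set" where
  "hanging h = {v \<in> verts G. l < top_bag v \<and> blk v = h}"

text \<open>Key \<open>2 * h\<close> is that of \<open>hanging h\<close>, key
  \<open>2 * h + 1\<close> that of the vertices with topmost bag \<open>h\<close> on the path;
  sorting by it gives the intended circular order.\<close>

definition key :: "'a \<Rightarrow> nat" where
  "key v = 2 * blk v + (if top_bag v \<le> l then 1 else 0)"

lemma path_verts_eq: "path_verts = (\<Union>j\<le>l. Y j)"
proof
  show "path_verts \<subseteq> (\<Union>j\<le>l. Y j)" using top_bag_in by (auto simp: path_verts_def)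
  show "(\<Union>j\<le>l. Y j) \<subseteq> path_verts"
    using bag_sub top_bag_le by (fastforce simp: path_verts_def intro: order_trans)
qed

text \<open>An edge stays inside one hanging set, or one end lies in all path bags between the
  blocks of its ends. So an edge avoiding a path bag does not straddle it.\<close>

lemma edge_blockE:
  assumes "e \<in> edges G"
  obtains u v where "e = {u, v}" "u \<in> verts G" "v \<in> verts G"
    "(l < top_bag u \<and> l < top_bag v \<and> blk u = blk v) \<or>
     (blk u \<le> blk v \<and> (\<forall>g. blk u \<le> g \<longrightarrow> g \<le> blk v \<longrightarrow> u \<in> Y g))"
proof -
  obtain u v where uv: "e = {u, v}" "u \<in> verts G" "v \<in> verts G" "u \<in> Y (top_bag v)"
    "top_bag u \<le> top_bag v" using edgeE[OF assms] by metis
  have "(l < top_bag u \<and> l < top_bag v \<and> blk u = blk v) \<or>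
     (blk u \<le> blk v \<and> (\<forall>g. blk u \<le> g \<longrightarrow> g \<le> blk v \<longrightarrow> u \<in> Y g))"
    using bag_block[OF uv(4)] uv(5) path_bag_between[of u "blk v"] block_le[of "top_bag v"]
    by (auto simp: blk_def block_path)
  then show ?thesis using that uv by blast
qed

end

section \<open>Cuts in the circular order\<close>

locale labelled_bag_tree = bag_tree_path +
  fixes lab :: "'a \<Rightarrow> int" and n :: int
  assumes n: "n = int (card (verts G))"
    and lab_bij: "bij_betw lab (verts G) {0..<n}"
    and lab_key: "u \<in> verts G \<Longrightarrow> v \<in> verts G \<Longrightarrow> key u < key v \<Longrightarrow> lab u < lab v"
begin

lemma lab_range: "v \<in> verts G \<Longrightarrow> 0 \<le> lab v \<and> lab v < n"
  using lab_bij by (fastforce simp: bij_betw_def)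

lemma lab_inj: "u \<in> verts G \<Longrightarrow> v \<in> verts G \<Longrightarrow> lab u = lab v \<Longrightarrow> u = v"
  using lab_bij by (simp add: bij_betw_def inj_on_def)

lemma lab_surj:
  assumes "0 \<le> z" "z < n"
  obtains v where "v \<in> verts G" "lab v = z"
proof -
  have "z \<in> lab ` verts G" using lab_bij assms by (simp add: bij_betw_def)
  then show ?thesis using that by blast
qed

lemma lab_le_key: "u \<in> verts G \<Longrightarrow> v \<in> verts G \<Longrightarrow> lab u \<le> lab v \<Longrightarrow> key u \<le> key v"
  using lab_key by (meson not_le)

text \<open>The key of \<open>w\<close> is odd, so an edge inside a hanging set is on one side of
  it; any other edge avoiding the bag has both blocks on one side. The two forms are the cuts just
  after and just before \<open>w\<close>.\<close>

lemma cut_at_path_vertex: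
  assumes w: "w \<in> path_verts" and e: "{u, v} \<in> edges G" "{u, v} \<inter> Y (top_bag w) = {}"
  shows "lab u \<le> lab w \<longleftrightarrow> lab v \<le> lab w" "lab u < lab w \<longleftrightarrow> lab v < lab w"
proof -
  obtain a b where ab: "{u, v} = {a, b}" "a \<in> verts G" "b \<in> verts G"
    "(l < top_bag a \<and> l < top_bag b \<and> blk a = blk b) \<or>
     (blk a \<le> blk b \<and> (\<forall>g. blk a \<le> g \<longrightarrow> g \<le> blk b \<longrightarrow> a \<in> Y g))"
    using edge_blockE[OF e(1)] by metis
  have wV: "w \<in> verts G" and kw: "key w = 2 * top_bag w + 1"
    using w by (auto simp: path_verts_def key_def blk_def block_path)
  have kb: "2 * blk x \<le> key x" "key x \<le> 2 * blk x + 1" for x by (auto simp: key_def)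
  have "(key a < key w \<and> key b < key w) \<or> (key w < key a \<and> key w < key b)"
    using ab(4)
  proof
    assume "l < top_bag a \<and> l < top_bag b \<and> blk a = blk b"
    then have "key a = 2 * blk a" "key b = 2 * blk a" by (auto simp: key_def)
    then show ?thesis unfolding kw by presburger
  next
    assume asm: "blk a \<le> blk b \<and> (\<forall>g. blk a \<le> g \<longrightarrow> g \<le> blk b \<longrightarrow> a \<in> Y g)"
    have "a \<notin> Y (top_bag w)" using e(2) ab(1) by auto
    then have "blk b < top_bag w \<or> top_bag w < blk a" using asm not_less by blast
    then show ?thesis using asm kb[of a] kb[of b] unfolding kw by linarith
  qed
  then have "(lab a < lab w \<and> lab b < lab w) \<or> (lab w < lab a \<and> lab w < lab b)"
    using lab_key ab wV by blast
  moreover have "u = a \<and> v = b \<or> u = b \<and> v = a" using ab(1) by (auto simp: doubleton_eq_iff)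
  ultimately show "lab u \<le> lab w \<longleftrightarrow> lab v \<le> lab w" "lab u < lab w \<longleftrightarrow> lab v < lab w"
    by auto
qed

text \<open>An edge avoiding \<open>Y h\<close> is inside \<open>hanging h\<close> or has both
  blocks strictly on one side of \<open>h\<close>.\<close>

lemma cut_at_hanging:
  assumes e: "{u, v} \<in> edges G" "{u, v} \<inter> Y h = {}"
  shows "u \<in> hanging h \<longleftrightarrow> v \<in> hanging h"
    and "s \<in> hanging h \<Longrightarrow> u \<notin> hanging h \<Longrightarrow> v \<notin> hanging h \<Longrightarrow> lab u < lab s \<longleftrightarrow> lab v < lab s"
proof -
  obtain a b where ab: "{u, v} = {a, b}" "a \<in> verts G" "b \<in> verts G"
    "(l < top_bag a \<and> l < top_bag b \<and> blk a = blk b) \<or>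
     (blk a \<le> blk b \<and> (\<forall>g. blk a \<le> g \<longrightarrow> g \<le> blk b \<longrightarrow> a \<in> Y g))"
    using edge_blockE[OF e(1)] by metis
  have kb: "2 * blk x \<le> key x" "key x \<le> 2 * blk x + 1" for x by (auto simp: key_def)
  have "(a \<in> hanging h \<and> b \<in> hanging h) \<or> (blk a < h \<and> blk b < h) \<or> (h < blk a \<and> h < blk b)"
    using ab(4)
  proof
    assume "l < top_bag a \<and> l < top_bag b \<and> blk a = blk b"
    then show ?thesis using ab(2,3) by (auto simp: hanging_def)
  next
    assume asm: "blk a \<le> blk b \<and> (\<forall>g. blk a \<le> g \<longrightarrow> g \<le> blk b \<longrightarrow> a \<in> Y g)"
    have "a \<notin> Y h" using e(2) ab(1) by auto
    then have "blk b < h \<or> h < blk a" using asm not_less by blast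
    then show ?thesis using asm by linarith
  qed
  then have *: "(u \<in> hanging h \<and> v \<in> hanging h) \<or> (blk u < h \<and> blk v < h) \<or> (h < blk u \<and> h < blk v)"
    using ab(1) by (auto simp: doubleton_eq_iff)
  then show "u \<in> hanging h \<longleftrightarrow> v \<in> hanging h" by (auto simp: hanging_def)
  assume s: "s \<in> hanging h" and nh: "u \<notin> hanging h" "v \<notin> hanging h"
  have sV: "s \<in> verts G" and ks: "key s = 2 * h" using s by (auto simp: hanging_def key_def)
  have uvV: "u \<in> verts G" "v \<in> verts G" using ab(1,2,3) by (auto simp: doubleton_eq_iff)
  have "(key u < key s \<and> key v < key s) \<or> (key s < key u \<and> key s < key v)"
    using * nh kb[of u] kb[of v] unfolding ks by linarith
  then show "lab u < lab s \<longleftrightarrow> lab v < lab s"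
    using lab_key[OF uvV(1) sV] lab_key[OF uvV(2) sV] lab_key[OF sV uvV(1)] lab_key[OF sV uvV(2)]
    by linarith
qed

text \<open>The hanging set is exactly the class of key \<open>2 * h\<close>, and equal keys occupy
  consecutive labels.\<close>

lemma lab_hanging:
  assumes "hanging h \<noteq> {}"
  shows "lab ` hanging h = {Min (lab ` hanging h)..Max (lab ` hanging h)}"
proof
  have fin: "finite (lab ` hanging h)" using finite_verts by (simp add: hanging_def)
  then show "lab ` hanging h \<subseteq> {Min (lab ` hanging h)..Max (lab ` hanging h)}" by auto
  have "Min (lab ` hanging h) \<in> lab ` hanging h" "Max (lab ` hanging h) \<in> lab ` hanging h"
    using Min_in[OF fin] Max_in[OF fin] assms by simp_all
  then obtain a b where ab: "a \<in> hanging h" "b \<in> hanging h" "Min (lab ` hanging h) = lab a"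
      "Max (lab ` hanging h) = lab b"
    by (elim imageE)
  have abV: "a \<in> verts G" "b \<in> verts G" and kab: "key a = 2 * h" "key b = 2 * h"
    using ab by (auto simp: hanging_def key_def)
  show "{Min (lab ` hanging h)..Max (lab ` hanging h)} \<subseteq> lab ` hanging h"
  proof
    fix z assume z: "z \<in> {Min (lab ` hanging h)..Max (lab ` hanging h)}"
    then have "0 \<le> z" "z < n" using lab_range[OF abV(1)] lab_range[OF abV(2)] ab by auto
    then obtain w where w: "w \<in> verts G" "lab w = z" by (rule lab_surj)
    then have "2 * h \<le> key w" "key w \<le> 2 * h"
      using lab_le_key[OF abV(1) w(1)] lab_le_key[OF w(1) abV(2)] z ab kab by auto
    then have "key w = 2 * h" by simp
    then have "w \<in> hanging h" using w(1) unfolding hanging_def key_def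
      by (cases "top_bag w \<le> l") (simp_all, presburger)
    then show "z \<in> lab ` hanging h" using w(2) by blast
  qed
qed

lemma card_lab:
  assumes "I \<subseteq> {0..<n}"
  shows "card {v \<in> verts G. lab v \<in> I} = card I"
proof -
  have "lab ` {v \<in> verts G. lab v \<in> I} = I"
    using lab_bij assms by (fastforce simp: bij_betw_def)
  moreover have "inj_on lab {v \<in> verts G. lab v \<in> I}"
    using lab_bij by (auto simp: bij_betw_def inj_on_def)
  ultimately show ?thesis using card_image by metis
qed

text \<open>An arc of length \<open>m\<close> that begins just after \<open>u\<close> and ends with
  \<open>w\<close> is bounded by two cuts next to path vertices, each costing the edges at one
  bag.\<close>

lemma cut_between_path_verts:
  assumes u: "u \<in> path_verts" and w: "w \<in> path_verts" and m: "1 \<le> m" "m \<le> n"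
    and uw: "(lab u + m) mod n = lab w"
  obtains B where "B \<subseteq> verts G" "int (card B) = m"
    "card (crossing (verts G) B) \<le> 2 * t * max_degree G"
proof -
  have V: "u \<in> verts G" "w \<in> verts G" using u w by (auto simp: path_verts_def)
  note r = lab_range[OF V(1)] lab_range[OF V(2)]
  have uw': "lab w = lab u + m \<or> lab w = lab u + m - n"
  proof (cases "lab u + m < n")
    case True
    then show ?thesis using uw r m by simp
  next
    case False
    have "(lab u + m) mod n = (lab u + m - n) mod n" by simp
    also have "\<dots> = lab u + m - n" using False r m by (intro mod_pos_pos_trivial) auto
    finally show ?thesis using uw by simp
  qed
  \<comment> \<open>The second form is the arc running through \<open>0\<close>; for
    \<open>m = n\<close>, where \<open>lab u = lab w\<close>, it is the whole circle.\<close>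
  define B where "B = (if lab u < lab w then {v \<in> verts G. lab v \<in> {lab u<..lab w}}
      else {v \<in> verts G. lab v \<in> {0..lab w} \<union> {lab u<..<n}})"
  have cB: "int (card B) = m"
  proof (cases "lab u < lab w")
    case True
    then have "B = {v \<in> verts G. lab v \<in> {lab u<..lab w}}" by (simp add: B_def)
    moreover have "card \<dots> = card {lab u<..lab w}" using r by (intro card_lab) auto
    ultimately show ?thesis using True uw' r m by auto
  next
    case False
    then have "B = {v \<in> verts G. lab v \<in> {0..lab w} \<union> {lab u<..<n}}" by (simp add: B_def)
    also have "card \<dots> = card ({0..lab w} \<union> {lab u<..<n})" using r by (intro card_lab) auto
    also have "\<dots> = card {0..lab w} + card {lab u<..<n}"
      using False by (intro card_Un_disjoint) auto
    finally show ?thesis using False uw' r m by auto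
  qed
  have "crossing (verts G) B \<subseteq> incident_edges G (Y (top_bag u)) \<union> incident_edges G (Y (top_bag w))"
  proof
    fix e assume e: "e \<in> crossing (verts G) B"
    then have eE: "e \<in> edges G" by (simp add: crossing_def)
    then obtain x y where xy: "e = {x, y}" "x \<in> verts G" "y \<in> verts G" using edgeE by metis
    show "e \<in> incident_edges G (Y (top_bag u)) \<union> incident_edges G (Y (top_bag w))"
    proof (rule ccontr)
      assume "\<not> ?thesis"
      then have ne: "{x, y} \<inter> Y (top_bag u) = {}" "{x, y} \<inter> Y (top_bag w) = {}"
        using eE xy(1) by (auto simp: incident_edges_def)
      have "x \<in> B \<longleftrightarrow> y \<in> B"
        using cut_at_path_vertex(1)[OF u _ ne(1)] cut_at_path_vertex(1)[OF w _ ne(2)] eE xy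
          lab_range[OF xy(2)] lab_range[OF xy(3)]
        unfolding B_def by auto
      then show False using e xy(1) by (auto simp: crossing_def)
    qed
  qed
  then have "card (crossing (verts G) B) \<le>
      card (incident_edges G (Y (top_bag u)) \<union> incident_edges G (Y (top_bag w)))"
    using finite_edges[OF simple] by (intro card_mono) (auto simp: incident_edges_def)
  also have "\<dots> \<le> card (incident_edges G (Y (top_bag u))) + card (incident_edges G (Y (top_bag w)))"
    by (rule card_Un_le)
  also have "\<dots> \<le> 2 * t * max_degree G"
    using card_incident_bag[of "top_bag u"] card_incident_bag[of "top_bag w"] by simp
  finally have "card (crossing (verts G) B) \<le> 2 * t * max_degree G" .
  moreover have "B \<subseteq> verts G" by (auto simp: B_def)
  ultimately show ?thesis using that cB by blast
qed

end

text \<open>In different periods the comparison is decided by the periods alone. This transfers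
  comparisons of labels to labels unwrapped around the circle.\<close>

lemma shifted_le_iff:
  fixes p p' w n d d' :: int
  assumes "0 \<le> p" "p < n" "0 \<le> p'" "p' < n" "0 \<le> w" "w < n"
  shows "(p \<le> w \<longleftrightarrow> p' \<le> w) \<Longrightarrow> p + n * d \<le> w + n * d' \<longleftrightarrow> p' + n * d \<le> w + n * d'"
    and "(p < w \<longleftrightarrow> p' < w) \<Longrightarrow> p + n * d < w + n * d' \<longleftrightarrow> p' + n * d < w + n * d'"
proof -
  consider "d = d'" | "d + 1 \<le> d'" | "d' + 1 \<le> d" by linarith
  then have "d = d' \<or> n * d + n \<le> n * d' \<or> n * d' + n \<le> n * d"
  proof cases
    case 2
    then have "n * (d + 1) \<le> n * d'" using assms by (intro mult_left_mono) auto
    then show ?thesis by (simp add: distrib_left)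
  next
    case 3
    then have "n * (d' + 1) \<le> n * d" using assms by (intro mult_left_mono) auto
    then show ?thesis by (simp add: distrib_left)
  qed auto
  then show "(p \<le> w \<longleftrightarrow> p' \<le> w) \<Longrightarrow> p + n * d \<le> w + n * d' \<longleftrightarrow> p' + n * d \<le> w + n * d'"
    and "(p < w \<longleftrightarrow> p' < w) \<Longrightarrow> p + n * d < w + n * d' \<longleftrightarrow> p' + n * d < w + n * d'"
    using assms by auto
qed

section \<open>The partition around a dense arc\<close>

context labelled_bag_tree
begin

text \<open>\<open>Z\<close> is the arc from \<open>x\<close> to \<open>y\<close>, and
  \<open>B\<close> consists of what lies between \<open>Z\<close> and the hanging set together with
  a piece cut off the latter. The ends of \<open>Z\<close> and the hanging set cost one bag each,
  the piece costs \<open>q\<close> bags, hence the factor \<open>3 + q\<close>.\<close>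

lemma cut_around_arc:
  assumes h: "hanging h \<noteq> {}" "lab ` hanging h = {a..b}"
    and \<mu>: "0 < \<mu>" "\<mu> < n" and xy: "x \<le> y" "a - \<mu> \<le> x" "y \<le> b - \<mu>"
    and red: "x mod n \<in> lab ` path_verts" "y mod n \<in> lab ` path_verts"
    and q: "int (card (hanging h)) \<le> 2 ^ q * (y - x + 1)"
  obtains B W Z where "B \<union> W \<union> Z = verts G" "B \<inter> W = {}" "B \<inter> Z = {}" "W \<inter> Z = {}"
    "int (card B) \<le> \<mu>" "\<mu> \<le> int (card B + card Z)" "int (card Z) = y - x + 1"
    "2 * card Z \<le> card (verts G)"
    "card {e \<in> edges G. \<not> e \<subseteq> B \<and> \<not> e \<subseteq> W \<and> \<not> e \<subseteq> Z} \<le> (3 + q) * (t * max_degree G)"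
    "card (path_verts \<inter> Z) = card {z \<in> {x..y}. z mod n \<in> lab ` path_verts}"
proof -
  have hV: "hanging h \<subseteq> verts G" by (auto simp: hanging_def)
  have "{a..b} \<noteq> {}" using h by (metis image_is_empty)
  then have ab: "a \<le> b" by simp
  then have "a \<in> lab ` hanging h" "b \<in> lab ` hanging h" unfolding h(2) by auto
  then obtain sa sb where s: "sa \<in> hanging h" "a = lab sa" "sb \<in> hanging h" "b = lab sb"
    by (elim imageE)
  have rab: "0 \<le> a" "b < n" using s hV lab_range by auto
  have gap: "z \<notin> lab ` path_verts" if "a \<le> z" "z \<le> b" for z
  proof
    assume "z \<in> lab ` path_verts"
    then obtain w where w: "w \<in> path_verts" "lab w = z" by blast
    have "z \<in> lab ` hanging h" unfolding h(2) using that by simp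
    then obtain w' where w': "w' \<in> hanging h" "z = lab w'" by (rule imageE)
    have "w = w'"
      using lab_inj[of w w'] w w' hV by (auto simp: path_verts_def)
    then show False using w w' by (auto simp: path_verts_def hanging_def)
  qed
  \<comment> \<open>Otherwise the red point \<open>y\<close> would itself lie in the gap
    \<open>{a..b}\<close>; the same argument for \<open>x + n\<close> shows that the gap ends before
    the arc comes round again.\<close>
  have ya: "y < a"
  proof (rule ccontr)
    assume "\<not> y < a"
    then have "y mod n = y" "a \<le> y" "y \<le> b" using rab xy \<mu> by auto
    then show False using gap[of y] red by simp
  qed
  have bx: "b < x + n"
  proof (rule ccontr)
    assume nb: "\<not> b < x + n"
    have "x mod n = (x + n) mod n" by simp
    also have "\<dots> = x + n" using nb rab xy \<mu> by (intro mod_pos_pos_trivial) auto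
    finally show False using gap[of "x + n"] red nb xy \<mu> by simp
  qed
  \<comment> \<open>Labels unwrapped to the period starting at \<open>x\<close>. In it
    \<open>Z\<close>, \<open>B0\<close>, \<open>S\<close> and \<open>W0\<close> are the consecutive
    intervals \<open>{x..y}\<close>, \<open>{y<..<a}\<close>, \<open>{a..b}\<close> and
    \<open>{b<..<x + n}\<close>.\<close>
  define rep where "rep = (\<lambda>v. x + (lab v - x) mod n)"
  have rep_mod: "rep v mod n = lab v" if "v \<in> verts G" for v
    using lab_range[OF that] by (simp add: rep_def mod_add_right_eq)
  have rep_range: "x \<le> rep v" "rep v < x + n" for v using \<mu> by (auto simp: rep_def)
  have rep_shift: "\<exists>d. rep v = lab v + n * d" for v
  proof -
    have "rep v = lab v + n * (- ((lab v - x) div n))"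
      using minus_mod_eq_mult_div[of "lab v - x" n] by (simp add: rep_def algebra_simps)
    then show ?thesis by blast
  qed
  have rep_unique: "rep v = z" if "v \<in> verts G" "x \<le> z" "z < x + n" "z mod n = lab v" for v z
  proof -
    have "(lab v - x) mod n = (z mod n - x) mod n" using that by simp
    also have "\<dots> = (z - x) mod n" by (simp add: mod_diff_left_eq)
    also have "\<dots> = z - x" using that by (intro mod_pos_pos_trivial) auto
    finally show ?thesis by (simp add: rep_def)
  qed
  have rep_bij: "bij_betw rep (verts G) {x..<x + n}"
    unfolding bij_betw_def
  proof
    show "inj_on rep (verts G)"
    proof (rule inj_onI)
      fix u v assume "u \<in> verts G" "v \<in> verts G" "rep u = rep v"
      then show "u = v" using rep_mod[of u] rep_mod[of v] lab_inj by simp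
    qed
    show "rep ` verts G = {x..<x + n}"
    proof
      show "rep ` verts G \<subseteq> {x..<x + n}" using rep_range by auto
      show "{x..<x + n} \<subseteq> rep ` verts G"
      proof
        fix z assume z: "z \<in> {x..<x + n}"
        have "0 \<le> z mod n" "z mod n < n" using \<mu> by simp_all
        then obtain v where "v \<in> verts G" "lab v = z mod n" by (rule lab_surj)
        then show "z \<in> rep ` verts G" using rep_unique[of v z] z by force
      qed
    qed
  qed
  have card_rep: "card {v \<in> verts G. rep v \<in> I} = card I" if "I \<subseteq> {x..<x + n}" for I
  proof -
    have "rep ` {v \<in> verts G. rep v \<in> I} = I"
      using rep_bij that by (fastforce simp: bij_betw_def)
    moreover have "inj_on rep {v \<in> verts G. rep v \<in> I}"
      using rep_bij by (auto simp: bij_betw_def inj_on_def)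
    ultimately show ?thesis using card_image by metis
  qed
  obtain w1 where w1: "w1 \<in> path_verts" "x mod n = lab w1" using red(1) by (rule imageE)
  obtain w2 where w2: "w2 \<in> path_verts" "y mod n = lab w2" using red(2) by (rule imageE)
  have wV: "w1 \<in> verts G" "w2 \<in> verts G" using w1 w2 by (auto simp: path_verts_def)
  have rep_w: "rep w1 = x" "rep w2 = y"
    using rep_unique[OF wV(1), of x] rep_unique[OF wV(2), of y] w1 w2 \<mu> xy ya ab bx by auto
  define S where "S = hanging h"
  have S_rep: "S = {v \<in> verts G. rep v \<in> {a..b}}"
  proof -
    have "v \<in> S \<longleftrightarrow> rep v \<in> {a..b}" if v: "v \<in> verts G" for v
    proof
      assume "v \<in> S"
      then have "lab v \<in> {a..b}" using h(2) by (auto simp: S_def)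
      moreover from this have "rep v = lab v"
        using lab_range[OF v] ya xy bx by (intro rep_unique[OF v]) auto
      ultimately show "rep v \<in> {a..b}" by simp
    next
      assume r: "rep v \<in> {a..b}"
      then have "rep v mod n = rep v" using rab by auto
      then have "lab v \<in> lab ` S" using r rep_mod[OF v] h(2) by (simp add: S_def)
      then obtain w where "w \<in> S" "lab v = lab w" by (rule imageE)
      then show "v \<in> S" using v lab_inj[of v w] hV by (auto simp: S_def)
    qed
    then show ?thesis using hV by (auto simp: S_def)
  qed
  define Z where "Z = {v \<in> verts G. rep v \<in> {x..y}}"
  define B0 where "B0 = {v \<in> verts G. rep v \<in> {y<..<a}}"
  define W0 where "W0 = {v \<in> verts G. rep v \<in> {b<..<x + n}}"
  have cards: "int (card Z) = y - x + 1" "int (card B0) = a - y - 1" "int (card S) = b - a + 1"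
  proof -
    have "card Z = card {x..y}" unfolding Z_def using ya bx ab by (intro card_rep) auto
    moreover have "card B0 = card {y<..<a}" unfolding B0_def using xy bx ab by (intro card_rep) auto
    moreover have "card S = card {a..b}" unfolding S_rep using xy ya bx by (intro card_rep) auto
    ultimately show "int (card Z) = y - x + 1" "int (card B0) = a - y - 1" "int (card S) = b - a + 1"
      using xy ya ab by auto
  qed
  have "1 \<le> card Z" using cards(1) xy by linarith
  moreover have "card S \<le> 2 ^ q * card Z"
  proof -
    have "int (card S) \<le> int (2 ^ q * card Z)" using q cards(1) by (simp add: S_def)
    then show ?thesis by (simp only: of_nat_le_iff)
  qed
  \<comment> \<open>The number is \<open>\<mu>\<close> minus the size \<open>a - y - 1\<close> of
    \<open>B0\<close>. It is positive since \<open>a - \<mu> \<le> x \<le> y\<close>, so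
    \<open>nat\<close> loses nothing.\<close>
  moreover have "nat (y + \<mu> - a + 1) \<le> card S" using cards(3) xy by linarith
  ultimately obtain C where C: "C \<subseteq> S" "card C \<le> nat (y + \<mu> - a + 1)"
    "nat (y + \<mu> - a + 1) \<le> card C + card Z" "card (crossing S C) \<le> q * (t * max_degree G)"
    using approximate_cut[of "card Z" S q "nat (y + \<mu> - a + 1)"] hV by (auto simp: S_def)
  define B where "B = B0 \<union> C"
  define W where "W = W0 \<union> (S - C)"
  have fin: "finite B0" "finite C"
    using finite_verts C(1) hV by (auto simp: B0_def S_def intro: finite_subset)
  have B0S: "B0 \<inter> S = {}" by (auto simp: B0_def S_rep)
  have cardB: "card B = card B0 + card C"
    unfolding B_def using fin B0S C(1) by (intro card_Un_disjoint) auto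
  have union: "B \<union> W \<union> Z = verts G"
  proof -
    have "B \<union> W \<union> Z = B0 \<union> W0 \<union> S \<union> Z" using C(1) by (auto simp: B_def W_def)
    also have "\<dots> = verts G"
      using rep_range by (auto simp: B0_def W0_def S_rep Z_def not_less not_le)
    finally show ?thesis .
  qed
  have disj: "B \<inter> W = {}" "B \<inter> Z = {}" "W \<inter> Z = {}"
    using C(1) ya ab bx by (auto simp: B_def W_def B0_def W0_def S_rep Z_def)
  have szB: "int (card B) \<le> \<mu>" "\<mu> \<le> int (card B + card Z)"
    using cardB cards C(2,3) xy by auto
  \<comment> \<open>The arc is no longer than the gap, and both fit disjointly into one
    period.\<close>
  have half: "2 * card Z \<le> card (verts G)"
    using cards(1) n xy ya bx ab by linarith
  have "{e \<in> edges G. \<not> e \<subseteq> B \<and> \<not> e \<subseteq> W \<and> \<not> e \<subseteq> Z} \<subseteq> incident_edges G (Y (top_bag w1))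
      \<union> incident_edges G (Y (top_bag w2)) \<union> incident_edges G (Y h) \<union> crossing S C" (is "?E \<subseteq> ?F")
  proof
    fix e assume e: "e \<in> ?E"
    then obtain u v where uv: "e = {u, v}" "u \<in> verts G" "v \<in> verts G" using edgeE[of e] by blast
    have eE: "{u, v} \<in> edges G" using e uv by simp
    show "e \<in> ?F"
    proof (rule ccontr)
      assume ne: "e \<notin> ?F"
      then have i: "{u, v} \<inter> Y (top_bag w1) = {}" "{u, v} \<inter> Y (top_bag w2) = {}" "{u, v} \<inter> Y h = {}"
        using eE uv(1) by (auto simp: incident_edges_def)
      show False
      proof (cases "u \<in> S")
        case True
        then have "e \<subseteq> S" using cut_at_hanging(1)[OF eE i(3)] uv(1) by (auto simp: S_def)
        moreover have "e \<notin> crossing S C" using ne by blast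
        ultimately have "e \<inter> C = {} \<or> e \<subseteq> C" using e by (auto simp: crossing_def)
        then have "e \<subseteq> B \<or> e \<subseteq> W" using \<open>e \<subseteq> S\<close> by (auto simp: B_def W_def)
        then show False using e by blast
      next
        case False
        then have nS: "u \<notin> S" "v \<notin> S" using cut_at_hanging(1)[OF eE i(3)] by (auto simp: S_def)
        obtain du where du: "rep u = lab u + n * du" using rep_shift by blast
        obtain dv where dv: "rep v = lab v + n * dv" using rep_shift by blast
        obtain d1 where d1: "x = lab w1 + n * d1" using rep_shift[of w1] rep_w by auto
        obtain d2 where d2: "y = lab w2 + n * d2" using rep_shift[of w2] rep_w by auto
        note ru = lab_range[OF uv(2)] and rv = lab_range[OF uv(3)]
        note r1 = lab_range[OF wV(1)] and r2 = lab_range[OF wV(2)]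
        have ra: "0 \<le> a" "a < n" using rab ab by auto
        \<comment> \<open>The period of an unwrapped label depends only on the side of
          \<open>w1\<close> on which the label lies, and the edge does not cross the cut before
          \<open>w1\<close>.\<close>
        have "du = dv"
        proof -
          have *: "dd = d1 + (if p < lab w1 then 1 else 0)"
            if "0 \<le> p" "p < n" "x \<le> p + n * dd" "p + n * dd < x + n" for p dd
          proof -
            have lo: "n * dd + n \<le> n * d1" if "dd < d1"
              using mult_left_mono[of "dd + 1" d1 n] that \<mu> by (simp add: distrib_left)
            have hi: "n * d1 + n * 2 \<le> n * dd" if "d1 + 1 < dd"
              using mult_left_mono[of "d1 + 2" dd n] that \<mu> by (simp add: distrib_left)
            have "\<not> dd < d1" using lo that d1 r1 by linarith
            moreover have "\<not> d1 + 1 < dd" using hi that d1 r1 by linarith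
            ultimately have "dd = d1 \<or> dd = d1 + 1" by linarith
            then show ?thesis using that d1 by (auto simp: distrib_left)
          qed
          have "lab u < lab w1 \<longleftrightarrow> lab v < lab w1"
            using cut_at_path_vertex(2)[OF w1(1) eE i(1)] .
          then show ?thesis
            using *[of "lab u" du] *[of "lab v" dv] ru rv rep_range[of u] rep_range[of v] du dv by simp
        qed
        have "rep u \<le> y \<longleftrightarrow> rep v \<le> y"
          unfolding du dv \<open>du = dv\<close> d2 using ru rv r2
          by (intro shifted_le_iff(1) cut_at_path_vertex(1)[OF w2(1) eE i(2)]) auto
        moreover have "rep u < a \<longleftrightarrow> rep v < a"
        proof -
          have "lab u < a \<longleftrightarrow> lab v < a"
            using cut_at_hanging(2)[OF eE i(3) s(1)] nS s(2) by (simp add: S_def)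
          then show ?thesis
            using shifted_le_iff(2)[of "lab u" n "lab v" a dv 0] ru rv ra du dv \<open>du = dv\<close> by simp
        qed
        \<comment> \<open>Outside \<open>S\<close>, the sides of \<open>y\<close> and
          \<open>a\<close> determine which of the three intervals contains a vertex.\<close>
        ultimately have "e \<subseteq> B0 \<or> e \<subseteq> W0 \<or> e \<subseteq> Z"
          using nS uv rep_range[of u] rep_range[of v]
          unfolding B0_def W0_def Z_def S_rep by (auto simp: not_less not_le)
        then show False using e by (auto simp: B_def W_def)
      qed
    qed
  qed
  then have "card ?E \<le> card ?F"
    using finite_edges[OF simple] finite_crossing by (intro card_mono) (auto simp: incident_edges_def)
  also have "card ?F \<le> card (incident_edges G (Y (top_bag w1))) + card (incident_edges G (Y (top_bag w2)))
      + card (incident_edges G (Y h)) + card (crossing S C)"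
    by (intro order_trans[OF card_Un_le] add_mono card_Un_le order_refl)
  also have "\<dots> \<le> t * max_degree G + t * max_degree G + t * max_degree G + q * (t * max_degree G)"
    by (intro add_mono card_incident_bag C(4))
  also have "\<dots> = (3 + q) * (t * max_degree G)" by (simp add: algebra_simps)
  finally have cut: "card ?E \<le> (3 + q) * (t * max_degree G)" .
  have "path_verts \<inter> Z = {v \<in> verts G. rep v \<in> {z \<in> {x..y}. z mod n \<in> lab ` path_verts}}"
  proof -
    have "v \<in> path_verts \<longleftrightarrow> lab v \<in> lab ` path_verts" if "v \<in> verts G" for v
      using that lab_inj[of v] by (auto simp: path_verts_def)
    moreover have "path_verts \<subseteq> verts G" by (auto simp: path_verts_def)
    ultimately show ?thesis using rep_mod by (auto simp: Z_def)
  qed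
  also have "card \<dots> = card {z \<in> {x..y}. z mod n \<in> lab ` path_verts}"
    using ya ab bx by (intro card_rep) auto
  finally have "card (path_verts \<inter> Z) = card {z \<in> {x..y}. z mod n \<in> lab ` path_verts}" .
  then show ?thesis using that union disj szB cards(1) half cut by blast
qed

end

section \<open>The partition\<close>

lemma cut_size_two:
  assumes "simple_graph G" "B \<inter> W = {}"
  shows "cut_size G [B, W] \<le> card {e \<in> edges G. \<not> e \<subseteq> B \<and> \<not> e \<subseteq> W}"
  unfolding cut_size_def
proof (rule card_mono)
  show "finite {e \<in> edges G. \<not> e \<subseteq> B \<and> \<not> e \<subseteq> W}" using finite_edges[OF assms(1)] by simp
qed (use assms(2) in \<open>auto simp: less_Suc_eq numeral_2_eq_2\<close>)

lemma cut_size_three: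
  assumes "simple_graph G" "B \<inter> W = {}" "B \<inter> Z = {}" "W \<inter> Z = {}"
  shows "cut_size G [B, W, Z] \<le> card {e \<in> edges G. \<not> e \<subseteq> B \<and> \<not> e \<subseteq> W \<and> \<not> e \<subseteq> Z}"
  unfolding cut_size_def
proof (rule card_mono)
  show "finite {e \<in> edges G. \<not> e \<subseteq> B \<and> \<not> e \<subseteq> W \<and> \<not> e \<subseteq> Z}"
    using finite_edges[OF assms(1)] by simp
qed (use assms(2-4) in \<open>auto simp: less_Suc_eq numeral_3_eq_3\<close>)

lemma ordered_partition_three:
  assumes "B \<union> W \<union> Z = V" "B \<inter> W = {}" "B \<inter> Z = {}" "W \<inter> Z = {}"
  shows "ordered_partition [B, W, Z] V"
  using assms by (auto simp: ordered_partition_def less_Suc_eq numeral_3_eq_3)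

text \<open>For the least \<open>q\<close> with \<open>S \<le> 2 ^ q * s\<close>, failure of
  \<open>q - 1\<close> gives \<open>2 ^ (q - 1) * s < S\<close>, which is compared with
  \<open>r * S \<le> n * s\<close>.\<close>

lemma halving_exponent:
  fixes S s r n :: nat
  assumes "r * S \<le> n * s" "1 \<le> s" "r \<le> n"
  obtains q where "S \<le> 2 ^ q * s" "2 ^ q * r \<le> 2 * n"
proof -
  have "S < 2 ^ S" by (rule less_exp)
  also have "2 ^ S \<le> 2 ^ S * s" using assms(2) by simp
  finally have ex: "S \<le> 2 ^ S * s" by simp
  define q where "q = (LEAST q. S \<le> 2 ^ q * s)"
  have q: "S \<le> 2 ^ q * s" unfolding q_def using ex by (rule LeastI)
  have "2 ^ q * r \<le> 2 * n"
  proof (cases q)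
    case 0
    then show ?thesis using assms(3) by simp
  next
    case (Suc k)
    then have "\<not> S \<le> 2 ^ k * s" using not_less_Least[of k "\<lambda>q. S \<le> 2 ^ q * s"] by (simp add: q_def)
    then have "r * (2 ^ k * s) \<le> r * S" by simp
    also have "\<dots> \<le> n * s" by (rule assms(1))
    finally have "(2 ^ k * r) * s \<le> n * s" by (simp add: ac_simps)
    then have "2 ^ k * r \<le> n" using assms(2) by simp
    then show ?thesis by (simp add: Suc)
  qed
  with q show ?thesis using that by blast
qed

theorem theorem4p2:
  fixes G :: "'a ugraph" and T :: "'b ugraph" and X :: "'b \<Rightarrow> 'a set"
    and P :: "'b list" and n t m :: nat
  assumes "simple_graph G"
    and "card (verts G) = n"
    and "tree_decomposition G T X"
    and "width T X \<le> int t - 1"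
    and "is_path T P"
    and "nonredundant X P"
    and "m \<in> {1..n}"
  shows "\<exists>B W Z. ordered_partition [B, W, Z] (verts G) \<and>
    ((card B = m \<and> Z = {} \<and> cut_size G [B, W] \<le> 2 * t * max_degree G) \<or>
     (card B \<le> m \<and> m \<le> card B + card Z \<and>
      0 < card Z \<and> real (card Z) \<le> real n / 2 \<and>
      real (cut_size G [B, W, Z])
        \<le> real t * real (max_degree G) * log 2 (16 / rel_weight G X P) \<and>
      (\<exists>(T' :: nat ugraph) X' P'.
         tree_decomposition (induced G Z) T' X' \<and>
         width T' X' \<le> int t - 1 \<and>
         is_path T' P' \<and>
         nonredundant X' P' \<and>
         rel_weight (induced G Z) X' P' \<ge> 2 * rel_weight G X P)))"
proof -
  obtain Y par N where Y: "\<And>j. par j \<le> j - 1"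
    "\<And>i j. i < j \<Longrightarrow> Y j \<inter> Y i \<subseteq> Y (par j)"
    "\<And>j. Y j \<subseteq> verts G" "\<And>j. card (Y j) \<le> t"
    "\<And>v. v \<in> verts G \<Longrightarrow> \<exists>j. v \<in> Y j"
    "\<And>e. e \<in> edges G \<Longrightarrow> \<exists>j. e \<subseteq> Y j"
    and N: "\<And>j. N \<le> j \<Longrightarrow> Y j = {}" "length P \<le> N"
    and YP: "\<And>j. j < length P \<Longrightarrow> Y j = X (P ! j)"
    and parP: "\<And>j. j < length P \<Longrightarrow> par j = j - 1"
    by (rule tree_decomposition_enumeration[OF assms(3,4,5)]) (rule that)
  have P0: "P \<noteq> []" using assms(5) by (simp add: is_path_def)
  define l where "l = length P - 1"
  have l: "j \<le> l \<longleftrightarrow> j < length P" for j using P0 by (cases P) (auto simp: l_def)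
  interpret bag_tree_path G Y par t l
    using assms(1) Y parP l by unfold_locales auto
  obtain lab :: "'a \<Rightarrow> int" where lab: "bij_betw lab (verts G) {0..<int (card (verts G))}"
    "\<And>u v. u \<in> verts G \<Longrightarrow> v \<in> verts G \<Longrightarrow> key u < key v \<Longrightarrow> lab u < lab v"
    by (rule sorted_labelling[OF finite_verts, where key = key]) (rule that)
  interpret labelled_bag_tree G Y par t l lab "int n"
    using lab assms(2) by unfold_locales auto
  define R where "R = path_verts"
  define r where "r = card R"
  have RV: "R \<subseteq> verts G" by (auto simp: R_def path_verts_def)
  have RP: "R = (\<Union>i\<in>set P. X i)"
    unfolding R_def path_verts_eq using YP by (fastforce simp: l in_set_conv_nth)
  \<comment> \<open>Nonredundancy supplies a nonempty bag at an end, so \<open>R\<close> is nonempty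
    and the relative weight positive.\<close>
  have "X (hd P) \<noteq> {} \<or> X (last P) \<noteq> {}"
    using assms(6) by (auto simp: nonredundant_def nonredundant_start_def hd_rev)
  then have R0: "R \<noteq> {}" unfolding RP using P0 by (metis SUP_bot_conv(2) hd_in_set last_in_set)
  have fR: "finite R" using RV finite_verts finite_subset by blast
  have r0: "0 < r" using R0 fR by (simp add: r_def card_gt_0_iff)
  have rn: "r \<le> n" using card_mono[OF finite_verts RV] assms(2) by (simp add: r_def)
  have n0: "0 < n" using r0 rn by simp
  have w: "rel_weight G X P = real r / real n"
    unfolding rel_weight_def RP[symmetric] r_def assms(2) ..
  define Red where "Red = lab ` R"
  show ?thesis
  proof (cases "\<exists>z\<in>Red. (z + int m) mod int n \<in> Red")
    case True
    then obtain u v where uv: "u \<in> path_verts" "v \<in> path_verts" "(lab u + int m) mod int n = lab v"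
      by (auto simp: Red_def R_def)
    obtain B where B: "B \<subseteq> verts G" "int (card B) = int m"
        "card (crossing (verts G) B) \<le> 2 * t * max_degree G"
      using cut_between_path_verts[OF uv(1,2) _ _ uv(3)] assms(7) by auto
    have "{e \<in> edges G. \<not> e \<subseteq> B \<and> \<not> e \<subseteq> verts G - B} \<subseteq> crossing (verts G) B"
      using simple by (auto simp: crossing_def simple_graph_def)
    then have "card {e \<in> edges G. \<not> e \<subseteq> B \<and> \<not> e \<subseteq> verts G - B} \<le> card (crossing (verts G) B)"
      by (intro card_mono finite_crossing)
    then have "cut_size G [B, verts G - B] \<le> 2 * t * max_degree G"
      using cut_size_two[OF simple, of B "verts G - B"] B(3) by auto
    moreover have "ordered_partition [B, verts G - B, {}] (verts G)"
      using B(1) by (intro ordered_partition_three) auto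
    ultimately show ?thesis using B(2) by (intro exI[of _ B] exI[of _ "verts G - B"] exI[of _ "{}"]) auto
  next
    case False
    then have shift: "(z + int m) mod int n \<notin> Red" if "z \<in> Red" for z using that by blast
    have labR: "0 \<le> z" "z < int n" if "z \<in> Red" for z
      using that lab_range RV by (auto simp: Red_def)
    have Red0: "Red \<noteq> {}" using R0 by (simp add: Red_def)
    \<comment> \<open>The shift by \<open>n\<close> fixes every red label, so \<open>m = n\<close>
      belongs to the first case.\<close>
    have "m \<noteq> n"
    proof
      assume "m = n"
      obtain z where z: "z \<in> Red" using Red0 by blast
      then have "(z + int m) mod int n = z" using labR[OF z] \<open>m = n\<close> by simp
      then show False using shift[OF z] z by simp
    qed
    then have m: "0 < int m" "int m < int n" using assms(7) by auto
    define H where "H = {h. h \<le> l \<and> hanging h \<noteq> {}}"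
    define a where "a = (\<lambda>h. Min (lab ` hanging h))"
    define b where "b = (\<lambda>h. Max (lab ` hanging h))"
    have ab: "lab ` hanging h = {a h..b h}" if "h \<in> H" for h
      using lab_hanging[of h] that by (simp add: H_def a_def b_def)
    have hV: "hanging h \<subseteq> verts G" for h by (auto simp: hanging_def)
    have disj: "{a g..b g} \<inter> {a h..b h} = {}" if gh: "g \<in> H" "h \<in> H" "g \<noteq> h" for g h
    proof -
      have "lab ` hanging g \<inter> lab ` hanging h = lab ` (hanging g \<inter> hanging h)"
        using inj_on_image_Int[OF _ hV hV, of lab] lab_bij by (auto simp: bij_betw_def)
      also have "hanging g \<inter> hanging h = {}" using gh(3) by (auto simp: hanging_def)
      finally show ?thesis using ab gh by simp
    qed
    have cover: "(\<Union>h\<in>H. {a h..b h}) = {0..<int n} - Red"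
    proof -
      have "(\<Union>h\<in>H. {a h..b h}) = (\<Union>h\<in>H. lab ` hanging h)"
        by (intro SUP_cong refl) (simp add: ab)
      also have "\<dots> = lab ` (\<Union>h\<in>H. hanging h)" by (simp add: image_UN)
      also have "(\<Union>h\<in>H. hanging h) = verts G - R"
      proof
        show "(\<Union>h\<in>H. hanging h) \<subseteq> verts G - R"
          by (auto simp: hanging_def R_def path_verts_def)
        show "verts G - R \<subseteq> (\<Union>h\<in>H. hanging h)"
        proof
          fix v assume "v \<in> verts G - R"
          then have "v \<in> hanging (blk v)" by (auto simp: hanging_def R_def path_verts_def)
          moreover from this have "blk v \<in> H" using block_le by (auto simp: H_def blk_def)
          ultimately show "v \<in> (\<Union>h\<in>H. hanging h)" by blast
        qed
      qed
      also have "lab ` (verts G - R) = lab ` verts G - Red"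
        unfolding Red_def using inj_on_image_set_diff[of lab "verts G" "verts G" R] lab_bij RV
        by (auto simp: bij_betw_def)
      also have "lab ` verts G = {0..<int n}" using lab_bij by (simp add: bij_betw_def)
      finally show ?thesis .
    qed
    have cRed: "card Red = r"
      unfolding Red_def r_def using lab_bij RV by (intro card_image) (auto simp: bij_betw_def inj_on_def)
    have "finite H" "Red \<subseteq> {0..<int n}" using labR by (auto simp: H_def)
    note dense_cyclic_arc[where a = a and b = b, OF m this(2) Red0 this(1) disj cover shift]
    then obtain h \<mu> x y where h: "h \<in> H" and \<mu>: "\<mu> \<in> {int m, int n - int m}"
      and xy: "x \<le> y" "a h - \<mu> \<le> x" "y \<le> b h - \<mu>" "x mod int n \<in> Red" "y mod int n \<in> Red"
      and dense: "int (card Red) * ((b h - a h + 1) + (y - x + 1))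
        \<le> int n * int (card {z \<in> {x..y}. z mod int n \<in> Red})"
      by blast
    have h0: "hanging h \<noteq> {}" using h by (simp add: H_def)
    define s where "s = nat (y - x + 1)"
    define k where "k = card {z \<in> {x..y}. z mod int n \<in> Red}"
    define S where "S = card (hanging h)"
    have s: "int s = y - x + 1" "1 \<le> s" using xy(1) by (auto simp: s_def)
    have "k \<le> card {x..y}" unfolding k_def by (intro card_mono) auto
    then have ks: "k \<le> s" by (simp add: s_def)
    have "S = card (lab ` hanging h)"
      unfolding S_def using lab_bij hV[of h] by (intro card_image[symmetric]) (auto simp: bij_betw_def inj_on_def)
    moreover have "{a h..b h} \<noteq> {}" using ab[OF h] h0 by (metis image_is_empty)
    ultimately have S: "int S = b h - a h + 1" using ab[OF h] by simp
    have "int (r * (S + s)) \<le> int (n * k)" using dense unfolding cRed k_def[symmetric] by (simp add: S s(1) algebra_simps)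
    then have dn: "r * (S + s) \<le> n * k" by (simp only: of_nat_le_iff)
    \<comment> \<open>The arc, moved by \<open>\<mu>\<close>, lies inside the gap.\<close>
    have "s \<le> S" using S s(1) xy by linarith
    have "r * S \<le> n * s"
    proof -
      have "r * S \<le> r * (S + s)" by simp
      also note dn
      also have "n * k \<le> n * s" using ks by simp
      finally show ?thesis .
    qed
    then obtain q where q: "S \<le> 2 ^ q * s" "2 ^ q * r \<le> 2 * n"
      using halving_exponent[OF _ s(2) rn] by blast
    have "int S \<le> int (2 ^ q * s)" using q(1) by (simp only: of_nat_le_iff)
    then have q': "int (card (hanging h)) \<le> 2 ^ q * (y - x + 1)" by (simp add: S_def s(1))
    have \<mu>0: "0 < \<mu>" "\<mu> < int n" using \<mu> m by auto
    obtain B W Z where BWZ: "B \<union> W \<union> Z = verts G" "B \<inter> W = {}" "B \<inter> Z = {}" "W \<inter> Z = {}"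
      and szB: "int (card B) \<le> \<mu>" "\<mu> \<le> int (card B + card Z)" and szZ: "int (card Z) = y - x + 1"
      and half: "2 * card Z \<le> card (verts G)"
      and cut: "card {e \<in> edges G. \<not> e \<subseteq> B \<and> \<not> e \<subseteq> W \<and> \<not> e \<subseteq> Z} \<le> (3 + q) * (t * max_degree G)"
      and RZ: "card (path_verts \<inter> Z) = card {z \<in> {x..y}. z mod int n \<in> lab ` path_verts}"
      by (rule cut_around_arc[OF h0 ab[OF h] \<mu>0 xy(1-3) xy(4,5)[unfolded Red_def R_def] q'])
        (rule that)
    have cZ: "card Z = s" using szZ s(1) by simp
    have ZV: "Z \<subseteq> verts G" using BWZ by blast
    have RZ': "card (R \<inter> Z) = k" using RZ by (simp add: R_def k_def Red_def)
    have "0 < k" using dn r0 s(2) by (cases k) auto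
    then have RZ0: "R \<inter> Z \<noteq> {}" using RZ' by auto
    \<comment> \<open>The constant \<open>16\<close> is \<open>2 ^ 3\<close> for the three extra
      bags times the factor \<open>2\<close> from rounding up to whole halvings.\<close>
    have lg: "3 + real q \<le> log 2 (16 / rel_weight G X P)"
    proof -
      have "real (2 ^ q * r) \<le> real (2 * n)" using q(2) by (simp only: of_nat_le_iff)
      then have "2 ^ (3 + q) \<le> 16 * real n / real r"
        using r0 by (simp add: power_add field_simps)
      also have "16 * real n / real r = 16 / rel_weight G X P" by (simp add: w)
      finally have "2 powr real (3 + q) \<le> 16 / rel_weight G X P"
        by (simp only: powr_realpow[of 2, simplified])
      moreover have "0 < 16 / rel_weight G X P" using r0 n0 by (simp add: w)
      ultimately show ?thesis by (simp add: le_log_iff)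
    qed
    have cut_log: "real c \<le> real t * real (max_degree G) * log 2 (16 / rel_weight G X P)"
      if "c \<le> card {e \<in> edges G. \<not> e \<subseteq> B \<and> \<not> e \<subseteq> W \<and> \<not> e \<subseteq> Z}" for c
    proof -
      have "real c \<le> real ((3 + q) * (t * max_degree G))" using that cut by (simp only: of_nat_le_iff)
      also have "\<dots> = real t * real (max_degree G) * (3 + real q)" by (simp add: algebra_simps)
      also have "\<dots> \<le> real t * real (max_degree G) * log 2 (16 / rel_weight G X P)"
        using lg by (intro mult_left_mono) auto
      finally show ?thesis .
    qed
    have tree: "\<exists>(T' :: nat ugraph) X' P'. tree_decomposition (induced G Z) T' X' \<and>
         width T' X' \<le> int t - 1 \<and> is_path T' P' \<and> nonredundant X' P' \<and>
         rel_weight (induced G Z) X' P' \<ge> 2 * rel_weight G X P"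
    proof -
      have vZ: "verts (induced G Z) = Z" using ZV by (auto simp: induced_def)
      \<comment> \<open>The bags are intersected with \<open>Z\<close> and the parent function is
        kept; the restricted path bags cover \<open>R \<inter> Z\<close>.\<close>
      have UZ: "(\<Union>j\<le>l. Y j \<inter> Z) = R \<inter> Z" unfolding R_def path_verts_eq by blast
      have "\<exists>(T' :: nat ugraph) X' P'. tree_decomposition (induced G Z) T' X' \<and>
         width T' X' \<le> int t - 1 \<and> is_path T' P' \<and> nonredundant X' P' \<and>
         (\<Union>i\<in>set P'. X' i) = (\<Union>j\<le>l. Y j \<inter> Z)"
      proof (rule bags_to_nat_tree_decomposition)
        show "par j \<le> j - 1" for j by (rule Y(1))
        show "(Y j \<inter> Z) \<inter> (Y i \<inter> Z) \<subseteq> Y (par j) \<inter> Z" if "i < j" for i j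
          using Y(2)[OF that] by blast
        show "Y j \<inter> Z \<subseteq> verts (induced G Z)" for j by (simp add: vZ)
        show "card (Y j \<inter> Z) \<le> t" for j
        proof -
          have "card (Y j \<inter> Z) \<le> card (Y j)"
            using finite_subset[OF Y(3) finite_verts] by (intro card_mono) auto
          then show ?thesis using Y(4)[of j] by simp
        qed
        show "\<exists>j. v \<in> Y j \<inter> Z" if "v \<in> verts (induced G Z)" for v
          using that Y(5)[of v] ZV by (auto simp: vZ)
        show "e \<noteq> {} \<and> (\<exists>j. e \<subseteq> Y j \<inter> Z)" if "e \<in> edges (induced G Z)" for e
          using that Y(6)[of e] simple by (auto simp: induced_def simple_graph_def)
        show "Y j \<inter> Z = {}" if "N \<le> j" for j using N(1)[OF that] by simp
        show "l < N" using l[of l] N(2) by simp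
        show "par j = j - 1" if "j \<le> l" for j using parP that l by simp
        show "(\<Union>j\<le>l. Y j \<inter> Z) \<noteq> {}" unfolding UZ by (rule RZ0)
      qed
      then obtain T' :: "nat ugraph" and X' P' where T': "tree_decomposition (induced G Z) T' X'"
         "width T' X' \<le> int t - 1" "is_path T' P'" "nonredundant X' P'"
         "(\<Union>i\<in>set P'. X' i) = R \<inter> Z"
        unfolding UZ by blast
      have "rel_weight (induced G Z) X' P' = real k / real s"
        by (simp add: rel_weight_def T'(5) RZ' vZ cZ)
      \<comment> \<open>From \<open>s \<le> S\<close> follows
        \<open>r * (2 * s) \<le> r * (S + s) \<le> n * k\<close>.\<close>
      moreover have "2 * (real r / real n) \<le> real k / real s"
      proof -
        have "r * (s + s) \<le> r * (S + s)" using \<open>s \<le> S\<close> by simp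
        also note dn
        finally have "real (r * (s + s)) \<le> real (n * k)" by (simp only: of_nat_le_iff)
        then show ?thesis using s(2) n0 by (simp add: field_simps)
      qed
      ultimately show ?thesis using T' w by metis
    qed
    have zz: "0 < card Z" "real (card Z) \<le> real n / 2"
      using cZ s(2) half assms(2) by auto
    \<comment> \<open>For the shift \<open>n - m\<close> the set \<open>B\<close> approximates
      \<open>n - m\<close>, so \<open>W\<close> approximates \<open>m\<close>, and the two exchange
      roles.\<close>
    from \<mu> consider "\<mu> = int m" | "\<mu> = int n - int m" by blast
    then show ?thesis
    proof cases
      case 1
      have "ordered_partition [B, W, Z] (verts G)"
        using BWZ by (intro ordered_partition_three)
      moreover have "card B \<le> m" "m \<le> card B + card Z" using szB 1 by linarith+
      moreover note cut_log[OF cut_size_three[OF simple BWZ(2-4)]]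
      ultimately show ?thesis using zz tree by blast
    next
      case 2
      have part: "ordered_partition [W, B, Z] (verts G)"
        using BWZ by (intro ordered_partition_three) auto
      have "card (verts G) = card B + card W + card Z"
      proof -
        have f: "finite B" "finite W" "finite Z"
          using BWZ(1) finite_verts by (metis Un_infinite finite_Un)+
        then show ?thesis
          unfolding BWZ(1)[symmetric] using BWZ(2-4) by (simp add: card_Un_disjoint Int_Un_distrib2)
      qed
      then have "card W \<le> m" "m \<le> card W + card Z" using szB 2 assms(2) by linarith+
      moreover have "cut_size G [W, B, Z] \<le> card {e \<in> edges G. \<not> e \<subseteq> B \<and> \<not> e \<subseteq> W \<and> \<not> e \<subseteq> Z}"
        using cut_size_three[OF simple, of W B Z] BWZ(2-4) by (auto simp: Int_commute conj_ac)
      note cut_log[OF this]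
      ultimately show ?thesis using zz tree part by blast
    qed
  qed
qed

end
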